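(* Let $1<p_i<\infty$ for $i\in\mathbb N$, and $\frac1p=\sum_{i=1}^\infty\frac1{p_i}$. Let $\omega_i$ be weights on $\mathbb R^n$ and let $\sigma_i=\omega_i^{-\frac1{p_i-1}}$, $i\in\mathbb N$, satisfying the standing assumptions listed in the context. Suppose that the nonnegative numbers $\{a_B\}_{B\in\mathcal D}$ satisfy, for some constant $A>0$, $$\sum_{B\in\mathcal D,\,B\subset G}a_B\le A\int_G\prod_{i=1}^\infty\sigma_i^{\frac p{p_i}}\,dx,\quad\forall G\in\mathcal D.$$ Then for all $\overrightarrow f\in\prod_{i=1}^\infty L^{p_i}(\sigma_i)$ we have $$\Big(\sum_{B\in\mathcal D}a_B\Big(\prod_{i=1}^\infty\frac1{\sigma_i(B)}\int_B f_i(y_i)\sigma_i(y_i)\,dy_i\Big)^p\Big)^{1/p}\le A^{\frac1p}\,\|\mathfrak M_d^{\overrightarrow\sigma}(\overrightarrow f)\|_{L^p(\nu_{\overrightarrow\sigma})}\le A^{\frac1p}\prod_{i=1}^\infty p_i'\,\|f_i\|_{L^{p_i}(\sigma_i)},$$ where $\nu_{\overrightarrow\sigma}=\prod_{i=1}^\infty\sigma_i^{\frac p{p_i}}$ and $\mathfrak M_d^{\overrightarrow\sigma}(\overrightarrow f)(x)=\sup_{x\in B\in\mathcal D}\prod_{i=1}^\infty\frac1{\sigma_i(B)}\int_B f_i(y_i)\sigma_i(y_i)\,dy_i$.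
   Context: A weight is a positive locally integrable function on $\mathbb R^n$. $|B|$ is Lebesgue measure, $\sigma_i(B)=\int_B\sigma_i\,dx$, $\frac1{p_i}+\frac1{p_i'}=1$, and $\|f\|_{L^{q}(\omega)}=(\int_{\mathbb R^n}|f|^q\omega\,dx)^{1/q}$. An infinite product $\prod_{i=1}^\infty c_i$ denotes $\lim_{n\to\infty}\prod_{i=1}^n c_i$; it converges if this limit exists (the limit may be $0$), and for nonnegative $c_i$ writing $\prod c_i<\infty$ means that it converges to a finite limit. Dyadic cubes: for $k\in\mathbb Z$, $\mathcal D_k$ is the family of half-open cubes $2^{-k}(m+[0,1)^n)$, $m\in\mathbb Z^n$, and $\mathcal D=\bigcup_{k\in\mathbb Z}\mathcal D_k$. For locally integrable $f$, $E_k(f)(x)=\sum_{B\in\mathcal D_k}\big(\frac1{|B|}\int_B f(y)\,dy\big)\chi_B(x)$. For weights $w_i$, $\overrightarrow f=(f_1,f_2,\dots)\in\prod_{i=1}^\infty L^{p_i}(w_i)$ means that the $f_i$ are nonnegative measurable functions on $\mathbb R^n$ with $f_i\in L^{p_i}(w_i)$ and $\prod_{i=1}^\infty\|f_i\|_{L^{p_i}(w_i)}<\infty$. Standing assumptions: the sum $\frac1p=\sum_i\frac1{p_i}$ is finite (so $0<p<\infty$); $\prod_{i=1}^\infty E_k(\sigma_i)^{1/p_i'}<\infty$ for all $k\in\mathbb Z$; $\prod_{i=1}^\infty\sigma_i^{1/p_i}>0$; and for every $B\in\mathcal D$, $(\sigma_1\chi_B,\sigma_2\chi_B,\dots)\in\prod_{i=1}^\infty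 L^{p_i}(\omega_i)$. *)

theory Defs
  imports "HOL-Analysis.Analysis"
begin

(* Power with a positive real exponent on the extended half-line; only r > 0 is ever used,
   so 0 is sent to 0 and \<infinity> to \<infinity>. *)
definition enn_powr :: "ennreal \<Rightarrow> real \<Rightarrow> ennreal" where
  "enn_powr x r = (if x = \<infinity> then \<infinity> else ennreal (enn2real x powr r))"

definition conj_exp :: "real \<Rightarrow> real" where
  "conj_exp r = r / (r - 1)"

(* Infinite products are plain limits of partial products, a limit 0 being allowed.  The library
   notions convergent_prod and prodinf differ: they call a product of nonzero factors tending to 0
   divergent.  Factors are indexed from 0. *)
definition prod_converges :: "(nat \<Rightarrow> ennreal) \<Rightarrow> bool" where
  "prod_converges c \<longleftrightarrow> convergent (\<lambda>n. \<Prod>i<n. c i)"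

definition infprod :: "(nat \<Rightarrow> ennreal) \<Rightarrow> ennreal" where
  "infprod c = lim (\<lambda>n. \<Prod>i<n. c i)"

definition prod_finite :: "(nat \<Rightarrow> ennreal) \<Rightarrow> bool" where
  "prod_finite c \<longleftrightarrow> prod_converges c \<and> infprod c < \<infinity>"

(* Positivity is required almost everywhere only, functions being considered up to null sets;
   this includes weights that are positive at every point. *)
definition weight :: "(real^'n \<Rightarrow> real) \<Rightarrow> bool" where
  "weight w \<longleftrightarrow> w \<in> borel_measurable lebesgue \<and> (AE x in lebesgue. 0 < w x) \<and>
     (\<forall>K. compact K \<longrightarrow> set_integrable lebesgue K w)"

definition dyadic_cube :: "int \<Rightarrow> int^'n \<Rightarrow> (real^'n) set" where
  "dyadic_cube k m = {x. \<forall>j. 2 powi (-k) * of_int (m $ j) \<le> x $ j \<and>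
                            x $ j < 2 powi (-k) * (of_int (m $ j) + 1)}"

definition dyadic_level :: "int \<Rightarrow> (real^'n) set set" where
  "dyadic_level k = range (dyadic_cube k)"

definition dyadic :: "(real^'n) set set" where
  "dyadic = (\<Union>k. dyadic_level k)"

definition E :: "int \<Rightarrow> (real^'n \<Rightarrow> real) \<Rightarrow> real^'n \<Rightarrow> real" where
  "E k f x = (\<Sum>\<^sub>\<infinity>B\<in>dyadic_level k.
                (1 / measure lebesgue B * (LINT y:B|lebesgue. f y)) * indicator B x)"

(* Norm of L^q(w); functions and weights are [0,\<infinity>]-valued because the maximal function and the
   product weight below are.  A real function f enters through its absolute value. *)
definition Lp_norm :: "real \<Rightarrow> (real^'n \<Rightarrow> ennreal) \<Rightarrow> (real^'n \<Rightarrow> ennreal) \<Rightarrow> ennreal" where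
  "Lp_norm q w g = enn_powr (\<integral>\<^sup>+x. enn_powr (g x) q * w x \<partial>lebesgue) (1 / q)"

abbreviation real_Lp_norm :: "real \<Rightarrow> (real^'n \<Rightarrow> real) \<Rightarrow> (real^'n \<Rightarrow> real) \<Rightarrow> ennreal" where
  "real_Lp_norm q w f \<equiv> Lp_norm q (\<lambda>x. ennreal (w x)) (\<lambda>x. ennreal \<bar>f x\<bar>)"

definition in_prod_Lp ::
    "(nat \<Rightarrow> real) \<Rightarrow> (nat \<Rightarrow> real^'n \<Rightarrow> real) \<Rightarrow> (nat \<Rightarrow> real^'n \<Rightarrow> real) \<Rightarrow> bool" where
  "in_prod_Lp ps w f \<longleftrightarrow>
     (\<forall>i. f i \<in> borel_measurable lebesgue \<and> (\<forall>x. 0 \<le> f i x) \<and>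
          real_Lp_norm (ps i) (w i) (f i) < \<infinity>) \<and>
     prod_finite (\<lambda>i. real_Lp_norm (ps i) (w i) (f i))"

definition waverage :: "(real^'n \<Rightarrow> real) \<Rightarrow> (real^'n) set \<Rightarrow> (real^'n \<Rightarrow> real) \<Rightarrow> ennreal" where
  "waverage s B f =
     1 / (\<integral>\<^sup>+y\<in>B. ennreal (s y) \<partial>lebesgue) * (\<integral>\<^sup>+y\<in>B. ennreal (f y * s y) \<partial>lebesgue)"

definition nu :: "real \<Rightarrow> (nat \<Rightarrow> real) \<Rightarrow> (nat \<Rightarrow> real^'n \<Rightarrow> real) \<Rightarrow> real^'n \<Rightarrow> ennreal" where
  "nu p ps \<sigma> x = infprod (\<lambda>i. ennreal (\<sigma> i x powr (p / ps i)))"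

definition dyadic_maximal ::
    "(nat \<Rightarrow> real^'n \<Rightarrow> real) \<Rightarrow> (nat \<Rightarrow> real^'n \<Rightarrow> real) \<Rightarrow> real^'n \<Rightarrow> ennreal" where
  "dyadic_maximal \<sigma> f x = (SUP B\<in>{B\<in>dyadic. x \<in> B}. infprod (\<lambda>i. waverage (\<sigma> i) B (f i)))"

end

theory Submission
  imports Defs
begin

text \<open>
  Both inequalities rest on the layer decomposition of a function that is a maximum of finitely
  many values v(B) on dyadic cubes B: a level set of such a function is a union of cubes, hence a
  disjoint union of maximal ones, so an estimate known for every cube passes to all level sets.
  Summed over the levels, the packing condition gives the Carleson embedding, and the averaging
  property of each v(B) gives Doob's inequality with the sharp constant for a single weight.

  The second inequality follows since the multilinear maximal function is at most the product of
  the maximal functions of the single weights, by Hoelder's inequality for infinitely many factors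
  and Doob's inequality in each factor. Every infinite product that occurs converges because it is
  dominated factor by factor by a product with a finite limit.
\<close>

section \<open>Powers and Hoelder inequalities on the extended half-line\<close>

text \<open>The difficulty lies in the infinite products: bounded partial products may oscillate, so
  no limit may be formed before its existence is known. For the averages over one cube B, Hoelder
  bounds the i-th factor by the norm of f_i times \<sigma>_i(B)^(-1/p_i). The product of the latter
  numbers is finite exactly when the product of \<sigma>_i(B)^(1/p_i) is not 0, and this is where
  positivity of the product weight enters. The product of the single-weight maximal functions at a
  point, in contrast, is never formed: a liminf replaces it, which Fatou's lemma can handle, and the
  comparison is made for one cube at a time.

  The factor p_i' comes from the identity d(t^q) = q' t d(t^(q-1)), which survives as an inequality
  for finite increments. The Doob argument bounds the q-th power of a norm by a constant times its
  (q-1)-st power and must divide; it is therefore run on finite families, where the norm is finite,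
  and extended by monotone convergence. The Carleson embedding is linear in the p-th powers of the
  averages, so A enters with the power 1/p and no other constant appears.\<close>

lemma enn_powr_top [simp]: "enn_powr top r = top"
  by (simp add: enn_powr_def)

lemma enn_powr_ennreal: "0 \<le> x \<Longrightarrow> enn_powr (ennreal x) r = ennreal (x powr r)"
  by (simp add: enn_powr_def)

lemma enn_powr_0 [simp]: "enn_powr 0 r = 0"
  by (simp add: enn_powr_def)

lemma enn_powr_1_left [simp]: "enn_powr 1 r = 1"
  by (simp add: enn_powr_def)

lemma enn_powr_1 [simp]: "enn_powr x 1 = x"
  by (cases x rule: ennreal_cases) (simp_all add: enn_powr_ennreal)

lemma enn_powr_mono: "x \<le> y \<Longrightarrow> 0 \<le> r \<Longrightarrow> enn_powr x r \<le> enn_powr y r"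
  by (cases x rule: ennreal_cases; cases y rule: ennreal_cases)
    (auto simp: enn_powr_ennreal intro!: ennreal_leI powr_mono2 simp: top.extremum_unique)

lemma enn_powr_eq_0_iff [simp]: "enn_powr x r = 0 \<longleftrightarrow> x = 0"
  by (cases x rule: ennreal_cases) (auto simp: enn_powr_ennreal)

lemma enn_powr_eq_top_iff [simp]: "enn_powr x r = top \<longleftrightarrow> x = top"
  by (simp add: enn_powr_def)

lemma enn_powr_less_top_iff [simp]: "enn_powr x r < top \<longleftrightarrow> x < top"
  using enn_powr_eq_top_iff[of x r] by (metis less_top)

text \<open>The conventions 0^r = 0 and \<infinity>^r = \<infinity> for every r agree with 0 *
  \<infinity> = 0, so the power laws need no sign condition on the exponent.\<close>

lemma enn_powr_mult: "enn_powr (x * y) r = enn_powr x r * enn_powr y r"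
proof -
  consider "x = 0 \<or> y = 0" | "x \<noteq> 0" "y \<noteq> 0" "x = top \<or> y = top" | "x \<noteq> top" "y \<noteq> top"
    by blast
  then show ?thesis
  proof cases
    case 2
    then have "x * y = top"
      by (auto simp: ennreal_mult_eq_top_iff)
    with 2 show ?thesis
      by (auto simp: ennreal_mult_eq_top_iff)
  next
    case 3
    then show ?thesis
      by (cases x rule: ennreal_cases; cases y rule: ennreal_cases)
        (auto simp: enn_powr_ennreal powr_mult simp flip: ennreal_mult)
  qed auto
qed

lemma enn_powr_prod: "enn_powr (\<Prod>i\<in>I. x i) r = (\<Prod>i\<in>I. enn_powr (x i) r)"
  by (induction I rule: infinite_finite_induct) (auto simp: enn_powr_mult)

lemma enn_powr_powr: "enn_powr (enn_powr x r) s = enn_powr x (r * s)"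
  by (cases x rule: ennreal_cases) (auto simp: enn_powr_ennreal powr_powr)

lemma enn_powr_add: "enn_powr x (r + s) = enn_powr x r * enn_powr x s"
  by (cases x rule: ennreal_cases) (auto simp: enn_powr_ennreal powr_add simp flip: ennreal_mult)

lemma enn_powr_powr_cancel [simp]:
  "r \<noteq> 0 \<Longrightarrow> enn_powr (enn_powr x r) (1 / r) = x"
  "r \<noteq> 0 \<Longrightarrow> enn_powr (enn_powr x (1 / r)) r = x"
  by (simp_all add: enn_powr_powr)

text \<open>For positive r the power is an order isomorphism of [0, \<infinity>] with inverse
  exponent \<open>1 / r\<close>. In this form continuity, also at infinity, can be read off the
  order topology.\<close>

lemma enn_powr_less_iff:
  assumes "0 < r"
  shows "x < enn_powr y r \<longleftrightarrow> enn_powr x (1 / r) < y"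
    and "enn_powr y r < x \<longleftrightarrow> y < enn_powr x (1 / r)"
proof -
  have "enn_powr y r \<le> x \<longleftrightarrow> y \<le> enn_powr x (1 / r)"
    using assms enn_powr_mono[of y "enn_powr x (1 / r)" r] enn_powr_mono[of "enn_powr y r" x "1 / r"]
    by auto
  then show "x < enn_powr y r \<longleftrightarrow> enn_powr x (1 / r) < y"
    by (simp add: not_le[symmetric] del: not_le)
  have "x \<le> enn_powr y r \<longleftrightarrow> enn_powr x (1 / r) \<le> y"
    using assms enn_powr_mono[of "enn_powr x (1 / r)" y r] enn_powr_mono[of x "enn_powr y r" "1 / r"]
    by auto
  then show "enn_powr y r < x \<longleftrightarrow> y < enn_powr x (1 / r)"
    by (simp add: not_le[symmetric] del: not_le)
qed

lemma tendsto_enn_powr [tendsto_intros]: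
  assumes "(X \<longlongrightarrow> L) F" "0 < r"
  shows "((\<lambda>n. enn_powr (X n) r) \<longlongrightarrow> enn_powr L r) F"
  unfolding order_tendsto_iff enn_powr_less_iff[OF assms(2)]
  using assms(1)[unfolded order_tendsto_iff] by blast

lemma enn_powr_SUP:
  assumes "0 < r"
  shows "enn_powr (SUP i\<in>I. x i) r = (SUP i\<in>I. enn_powr (x i) r)"
proof (rule antisym)
  let ?S = "SUP i\<in>I. enn_powr (x i) r"
  have "(SUP i\<in>I. x i) \<le> enn_powr ?S (1 / r)"
  proof (rule SUP_least)
    fix i assume "i \<in> I"
    then have "enn_powr (enn_powr (x i) r) (1 / r) \<le> enn_powr ?S (1 / r)"
      using assms by (intro enn_powr_mono SUP_upper) auto
    then show "x i \<le> enn_powr ?S (1 / r)"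
      using assms by simp
  qed
  from enn_powr_mono[OF this, of r] assms show "enn_powr (SUP i\<in>I. x i) r \<le> ?S"
    by simp
  show "?S \<le> enn_powr (SUP i\<in>I. x i) r"
    using assms by (intro SUP_least enn_powr_mono SUP_upper) auto
qed

lemma measurable_enn_powr [measurable]:
  assumes [measurable]: "f \<in> borel_measurable M"
  shows "(\<lambda>x. enn_powr (f x) r) \<in> borel_measurable M"
  unfolding enn_powr_def by measurable

section \<open>Weighted means and Hoelder inequalities\<close>

lemma ennreal_inverse_mult_cancel:
  fixes x :: ennreal
  assumes "x \<noteq> 0" "x \<noteq> top"
  shows "inverse x * x = 1"
  using assms ennreal_divide_self[of x] by (metis divide_ennreal_def mult.commute less_top)

text \<open>Jensen's inequality for the exponential function at the points
  \<open>ln (x i)\<close>.\<close>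

lemma weighted_arith_geom_mean:
  fixes x \<theta> :: "'i \<Rightarrow> real"
  assumes "finite I" "\<And>i. i \<in> I \<Longrightarrow> 0 < \<theta> i" "(\<Sum>i\<in>I. \<theta> i) = 1" "\<And>i. i \<in> I \<Longrightarrow> 0 < x i"
  shows "(\<Prod>i\<in>I. x i powr \<theta> i) \<le> (\<Sum>i\<in>I. \<theta> i * x i)"
proof -
  have "I \<noteq> {}"
    using assms(3) by auto
  have "(\<Prod>i\<in>I. x i powr \<theta> i) = exp (\<Sum>i\<in>I. \<theta> i *\<^sub>R ln (x i))"
    using assms by (auto simp: exp_sum powr_def intro!: prod.cong dest!: assms(4))
  also have "\<dots> \<le> (\<Sum>i\<in>I. \<theta> i * exp (ln (x i)))"
    using assms \<open>I \<noteq> {}\<close> by (intro convex_on_sum[OF _ _ exp_convex]) (auto intro: less_imp_le)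
  also have "\<dots> = (\<Sum>i\<in>I. \<theta> i * x i)"
    using assms by simp
  finally show ?thesis .
qed

lemma weighted_arith_geom_mean_ennreal:
  assumes "finite I" "\<And>i. i \<in> I \<Longrightarrow> 0 < \<theta> i" "(\<Sum>i\<in>I. \<theta> i) = 1"
  shows "(\<Prod>i\<in>I. enn_powr (x i) (\<theta> i)) \<le> (\<Sum>i\<in>I. ennreal (\<theta> i) * x i)"
proof -
  consider i where "i \<in> I" "x i = 0" | i where "i \<in> I" "x i = top"
    | "\<forall>i\<in>I. x i \<noteq> 0 \<and> x i \<noteq> top" by blast
  then show ?thesis
  proof cases
    case 1
    then have "(\<Prod>i\<in>I. enn_powr (x i) (\<theta> i)) = 0"
      using assms by (intro prod_zero) auto
    then show ?thesis by (metis zero_le)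
  next
    case 2
    then have "ennreal (\<theta> i) * x i = top"
      using assms(2)[of i] by (simp add: ennreal_mult_top)
    then have "(\<Sum>i\<in>I. ennreal (\<theta> i) * x i) = top"
      using 2 assms(1) by (subst ennreal_sum_eq_top) metis+
    then show ?thesis by simp
  next
    case 3
    define y where "y i = enn2real (x i)" for i
    have y: "x i = ennreal (y i)" "0 < y i" if "i \<in> I" for i
      using 3 that unfolding y_def by (auto simp: enn2real_positive_iff zero_less_iff_neq_zero top.not_eq_extremum)
    have "(\<Prod>i\<in>I. enn_powr (x i) (\<theta> i)) = ennreal (\<Prod>i\<in>I. y i powr \<theta> i)"
      using y by (auto simp: enn_powr_ennreal less_imp_le simp flip: prod_ennreal intro!: prod.cong)
    also have "\<dots> \<le> ennreal (\<Sum>i\<in>I. \<theta> i * y i)"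
      using assms y by (intro ennreal_leI weighted_arith_geom_mean) auto
    also have "\<dots> = (\<Sum>i\<in>I. ennreal (\<theta> i) * x i)"
      using y assms(2) by (subst sum_ennreal[symmetric]) (auto simp: ennreal_mult less_imp_le intro!: sum.cong mult_nonneg_nonneg)
    finally show ?thesis .
  qed
qed

text \<open>After division of each \<open>g i\<close> by its integral, the inequality of weighted
  means holds pointwise and its right side integrates to the sum of the exponents, which is 1. A
  vanishing integral is treated before an infinite one, because a zero factor makes the right side 0
  even next to an infinite factor.\<close>

lemma nn_integral_Hoelder_prod:
  assumes I: "finite I" "\<And>i. i \<in> I \<Longrightarrow> 0 < \<theta> i" "(\<Sum>i\<in>I. \<theta> i) = 1"
    and g [measurable]: "\<And>i. i \<in> I \<Longrightarrow> g i \<in> borel_measurable M"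
  shows "(\<integral>\<^sup>+x. (\<Prod>i\<in>I. enn_powr (g i x) (\<theta> i)) \<partial>M) \<le> (\<Prod>i\<in>I. enn_powr (\<integral>\<^sup>+x. g i x \<partial>M) (\<theta> i))"
proof -
  define J where "J i = (\<integral>\<^sup>+x. g i x \<partial>M)" for i
  consider i where "i \<in> I" "J i = 0" | i where "i \<in> I" "J i = top" "\<forall>i\<in>I. J i \<noteq> 0"
    | "\<forall>i\<in>I. J i \<noteq> 0 \<and> J i \<noteq> top" by blast
  then show ?thesis
  proof cases
    case 1
    then have "AE x in M. g i x = 0"
      unfolding J_def by (subst (asm) nn_integral_0_iff_AE) auto
    then have "AE x in M. (\<Prod>i\<in>I. enn_powr (g i x) (\<theta> i)) = 0"
      using 1 I by (auto intro!: prod_zero elim!: eventually_mono)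
    then have "(\<integral>\<^sup>+x. (\<Prod>i\<in>I. enn_powr (g i x) (\<theta> i)) \<partial>M) = 0"
      by (subst nn_integral_0_iff_AE) auto
    then show ?thesis by simp
  next
    case 2
    have "(\<Prod>i\<in>I. enn_powr (J i) (\<theta> i)) = top"
      using 2 I by (auto simp: prod.remove[OF I(1) 2(1)] ennreal_top_mult)
    then show ?thesis by (simp add: J_def)
  next
    case 3
    have *: "(\<Prod>i\<in>I. enn_powr (g i x) (\<theta> i)) \<le>
        (\<Prod>i\<in>I. enn_powr (J i) (\<theta> i)) * (\<Sum>i\<in>I. ennreal (\<theta> i) * (inverse (J i) * g i x))" for x
    proof -
      have "g i x = J i * (inverse (J i) * g i x)" if "i \<in> I" for i
        using 3 that by (simp add: mult.assoc[symmetric] mult.commute[of "J i"] ennreal_inverse_mult_cancel)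
      then have "(\<Prod>i\<in>I. enn_powr (g i x) (\<theta> i)) = (\<Prod>i\<in>I. enn_powr (J i * (inverse (J i) * g i x)) (\<theta> i))"
        by (intro prod.cong) auto
      also have "\<dots> = (\<Prod>i\<in>I. enn_powr (J i) (\<theta> i)) * (\<Prod>i\<in>I. enn_powr (inverse (J i) * g i x) (\<theta> i))"
        by (simp only: enn_powr_mult prod.distrib)
      also have "\<dots> \<le> (\<Prod>i\<in>I. enn_powr (J i) (\<theta> i)) * (\<Sum>i\<in>I. ennreal (\<theta> i) * (inverse (J i) * g i x))"
        using I by (intro mult_left_mono weighted_arith_geom_mean_ennreal) auto
      finally show ?thesis .
    qed
    have "(\<integral>\<^sup>+x. (\<Prod>i\<in>I. enn_powr (g i x) (\<theta> i)) \<partial>M) \<le>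
       (\<integral>\<^sup>+x. (\<Prod>i\<in>I. enn_powr (J i) (\<theta> i)) * (\<Sum>i\<in>I. ennreal (\<theta> i) * (inverse (J i) * g i x)) \<partial>M)"
      by (intro nn_integral_mono *)
    also have "\<dots> = (\<Prod>i\<in>I. enn_powr (J i) (\<theta> i)) * (\<Sum>i\<in>I. ennreal (\<theta> i) * (inverse (J i) * J i))"
      unfolding J_def by (simp add: nn_integral_cmult nn_integral_sum)
    also have "(\<Sum>i\<in>I. ennreal (\<theta> i) * (inverse (J i) * J i)) = (\<Sum>i\<in>I. ennreal (\<theta> i))"
      using 3 by (intro sum.cong) (auto simp: ennreal_inverse_mult_cancel)
    also have "\<dots> = 1"
      using I by (subst sum_ennreal) (auto intro: less_imp_le)
    finally show ?thesis by (simp add: J_def)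
  qed
qed

lemma nn_integral_Hoelder:
  assumes pq: "0 < p" "0 < q" "1 / p + 1 / q = 1"
    and [measurable]: "u \<in> borel_measurable M" "v \<in> borel_measurable M"
  shows "(\<integral>\<^sup>+x. u x * v x \<partial>M) \<le>
    enn_powr (\<integral>\<^sup>+x. enn_powr (u x) p \<partial>M) (1 / p) * enn_powr (\<integral>\<^sup>+x. enn_powr (v x) q \<partial>M) (1 / q)"
proof -
  define g where "g b x = (if b then enn_powr (u x) p else enn_powr (v x) q)" for b x
  have "(\<integral>\<^sup>+x. (\<Prod>b\<in>UNIV. enn_powr (g b x) (if b then 1 / p else 1 / q)) \<partial>M) \<le>
      (\<Prod>b\<in>UNIV. enn_powr (\<integral>\<^sup>+x. g b x \<partial>M) (if b then 1 / p else 1 / q))"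
    using pq by (intro nn_integral_Hoelder_prod) (auto simp: UNIV_bool g_def)
  then show ?thesis
    using pq by (simp add: UNIV_bool g_def mult.commute)
qed

text \<open>Fatou's lemma reduces the claim to partial products, on which finite Hoelder applies on
  sets of finite measure; these then exhaust the space. The pointwise product may fail to converge,
  hence the liminf; the product of the integrals may fail too, hence the convergent majorant
  \<open>b\<close>.\<close>

lemma nn_integral_Hoelder_infinite_prod:
  assumes M: "sigma_finite_measure M" and \<theta>: "\<And>i. 0 < \<theta> i" "\<theta> sums 1"
    and [measurable]: "\<And>i. g i \<in> borel_measurable M"
    and le: "\<And>n. (\<Prod>i<n. enn_powr (\<integral>\<^sup>+x. g i x \<partial>M) (\<theta> i)) \<le> b n" and b: "b \<longlonglongrightarrow> T"
  shows "(\<integral>\<^sup>+x. liminf (\<lambda>n. \<Prod>i<n. enn_powr (g i x) (\<theta> i)) \<partial>M) \<le> T"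
proof -
  interpret sigma_finite_measure M by fact
  define P where "P n x = (\<Prod>i<n. enn_powr (g i x) (\<theta> i))" for n x
  have [measurable]: "P n \<in> borel_measurable M" for n
    unfolding P_def by measurable
  have less_1: "(\<Sum>i<n. \<theta> i) < 1" for n
    using sum_less_suminf[of \<theta> n] \<theta> by (auto simp: sums_iff)
  have *: "(\<integral>\<^sup>+x. liminf (\<lambda>n. P n x) * indicator K x \<partial>M) \<le> T"
    if [measurable]: "K \<in> sets M" and "emeasure M K \<noteq> \<infinity>" for K
  \<comment> \<open>The powers of the measure of \<open>K\<close> used below tend to 1 only if that
    measure is positive.\<close>
  proof (cases "emeasure M K = 0")
    case True
    then show ?thesis
      by (simp add: nn_integral_null_set null_sets_def)
  next
    case False
    with that obtain k where k: "emeasure M K = ennreal k" "0 < k"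
      by (cases "emeasure M K" rule: ennreal_cases) (auto simp: zero_less_iff_neq_zero le_less)
    have "(\<integral>\<^sup>+x. liminf (\<lambda>n. P n x) * indicator K x \<partial>M) = (\<integral>\<^sup>+x. liminf (\<lambda>n. P n x * indicator K x) \<partial>M)"
      by (intro nn_integral_cong) (auto simp: indicator_def Liminf_const)
    also have "\<dots> \<le> liminf (\<lambda>n. \<integral>\<^sup>+x. P n x * indicator K x \<partial>M)"
      by (intro nn_integral_liminf) measurable
    also have "\<dots> \<le> liminf (\<lambda>n. b n * enn_powr (ennreal k) (1 - (\<Sum>i<n. \<theta> i)))"
    proof (intro Liminf_mono always_eventually allI)
      fix n
      \<comment> \<open>The exponents of a partial product add up to less than 1; the indicator of K carries the rest.\<close>
      define h where "h i = (if i < n then g i else indicator K)" for i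
      define \<eta> where "\<eta> i = (if i < n then \<theta> i else 1 - (\<Sum>i<n. \<theta> i))" for i
      have [measurable]: "h i \<in> borel_measurable M" for i
        by (auto simp: h_def)
      have ind: "enn_powr (indicator K x) r = indicator K x" for x r
        by (auto simp: indicator_def)
      have "(\<integral>\<^sup>+x. (\<Prod>i<Suc n. enn_powr (h i x) (\<eta> i)) \<partial>M) \<le> (\<Prod>i<Suc n. enn_powr (\<integral>\<^sup>+x. h i x \<partial>M) (\<eta> i))"
        using less_1 \<theta>(1) by (intro nn_integral_Hoelder_prod) (auto simp: \<eta>_def)
      then have "(\<integral>\<^sup>+x. P n x * indicator K x \<partial>M) \<le>
          (\<Prod>i<n. enn_powr (\<integral>\<^sup>+x. g i x \<partial>M) (\<theta> i)) * enn_powr (ennreal k) (1 - (\<Sum>i<n. \<theta> i))"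
        using k by (simp add: h_def \<eta>_def P_def ind mult.commute)
      also have "\<dots> \<le> b n * enn_powr (ennreal k) (1 - (\<Sum>i<n. \<theta> i))"
        by (intro mult_right_mono le) auto
      finally show "(\<integral>\<^sup>+x. P n x * indicator K x \<partial>M) \<le> b n * enn_powr (ennreal k) (1 - (\<Sum>i<n. \<theta> i))" .
    qed
    \<comment> \<open>The exponent left to \<open>K\<close> tends to 0, so the measure of
      \<open>K\<close> disappears from the bound and the estimate is uniform in
      \<open>K\<close>.\<close>
    also have "(\<lambda>n. b n * enn_powr (ennreal k) (1 - (\<Sum>i<n. \<theta> i))) \<longlonglongrightarrow> T * 1"
    proof (intro tendsto_mult_ennreal b)
      have "(\<lambda>n. k powr (1 - (\<Sum>i<n. \<theta> i))) \<longlonglongrightarrow> k powr (1 - 1)"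
        using k \<theta>(2) by (intro tendsto_intros) (auto simp: sums_def)
      then show "(\<lambda>n. enn_powr (ennreal k) (1 - (\<Sum>i<n. \<theta> i))) \<longlonglongrightarrow> 1"
        using k by (auto simp: enn_powr_ennreal simp flip: ennreal_1)
    qed auto
    then have "liminf (\<lambda>n. b n * enn_powr (ennreal k) (1 - (\<Sum>i<n. \<theta> i))) = T"
      by (simp add: lim_imp_Liminf)
    finally show ?thesis .
  qed
  obtain A where A: "range A \<subseteq> sets M" "(\<Union>i. A i) = space M" "\<And>i. emeasure M (A i) \<noteq> \<infinity>" "incseq A"
    using sigma_finite_incseq by metis
  have [measurable]: "A i \<in> sets M" for i
    using A by auto
  have "(\<integral>\<^sup>+x. liminf (\<lambda>n. P n x) \<partial>M) = (\<integral>\<^sup>+x. (SUP n. liminf (\<lambda>n. P n x) * indicator (A n) x) \<partial>M)"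
  proof (intro nn_integral_cong)
    fix x assume "x \<in> space M"
    then obtain n where "x \<in> A n"
      using A by blast
    then show "liminf (\<lambda>n. P n x) = (SUP n. liminf (\<lambda>n. P n x) * indicator (A n) x)"
      by (intro antisym SUP_least SUP_upper2[of n]) (auto simp: indicator_def)
  qed
  also have "\<dots> = (SUP n. \<integral>\<^sup>+x. liminf (\<lambda>n. P n x) * indicator (A n) x \<partial>M)"
    using A(4) by (intro nn_integral_monotone_convergence_SUP)
      (auto simp: incseq_def le_fun_def indicator_def)
  also have "\<dots> \<le> T"
    using A by (intro SUP_least *) auto
  finally show ?thesis
    by (simp add: P_def)
qed

section \<open>Infinite products\<close>

lemma prod_finiteI:
  assumes "(\<lambda>n. \<Prod>i<n. c i) \<longlonglongrightarrow> L" "L < \<infinity>"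
  shows "prod_finite c" "infprod c = L"
  using assms by (auto simp: prod_finite_def prod_converges_def infprod_def convergent_def limI)

lemma prod_converges_LIMSEQ: "prod_converges c \<Longrightarrow> (\<lambda>n. \<Prod>i<n. c i) \<longlonglongrightarrow> infprod c"
  by (simp add: prod_converges_def infprod_def convergent_LIMSEQ_iff)

lemma prod_finite_LIMSEQ: "prod_finite c \<Longrightarrow> (\<lambda>n. \<Prod>i<n. c i) \<longlonglongrightarrow> infprod c"
  by (simp add: prod_finite_def prod_converges_LIMSEQ)

lemma prod_finite_mult:
  assumes "prod_finite c" "prod_finite d"
  shows "prod_finite (\<lambda>i. c i * d i)" "infprod (\<lambda>i. c i * d i) = infprod c * infprod d"
proof -
  have fin: "infprod c < \<infinity>" "infprod d < \<infinity>"
    using assms by (auto simp: prod_finite_def)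
  then have *: "(\<lambda>n. \<Prod>i<n. c i * d i) \<longlonglongrightarrow> infprod c * infprod d"
    unfolding prod.distrib by (intro tendsto_mult_ennreal prod_finite_LIMSEQ assms) auto
  show "prod_finite (\<lambda>i. c i * d i)" "infprod (\<lambda>i. c i * d i) = infprod c * infprod d"
    using prod_finiteI[OF *] fin by (auto simp: ennreal_mult_less_top)
qed

text \<open>Boundedness of the partial products would not suffice. If no \<open>c i\<close> is 0,
  then the ratios \<open>c i / d i\<close> make sense and are at most 1, so their partial products
  decrease and converge; multiplying back by \<open>d\<close> gives the claim. A single zero factor
  makes the partial products eventually 0.\<close>

lemma prod_finite_le:
  assumes d: "prod_finite d" "\<And>i. d i < \<infinity>" and le: "\<And>i. c i \<le> d i"
  shows "prod_finite c"
proof (cases "\<exists>i. c i = 0")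
  case True
  then obtain i where "c i = 0" by blast
  then have "(\<Prod>j<n. c j) = 0" if "n > i" for n
    using that by (intro prod_zero) auto
  then have "(\<lambda>n. \<Prod>j<n. c j) \<longlonglongrightarrow> 0"
    by (intro tendsto_eventually) (auto simp: eventually_at_top_dense)
  then show ?thesis
    by (rule prod_finiteI) simp
next
  case False
  define r where "r i = c i / d i" for i
  have d0: "d i \<noteq> 0" for i
    using False le[of i] by auto
  have r: "c i = d i * r i" "r i \<le> 1" for i
  proof -
    show "c i = d i * r i"
      using d0[of i] d(2)[of i] by (simp add: r_def ennreal_times_divide ennreal_mult_divide_eq mult.commute)
    show "r i \<le> 1"
      using d0[of i] d(2)[of i] le[of i] unfolding r_def
      by (metis divide_right_mono_ennreal ennreal_divide_self infinity_ennreal_def)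
  qed
  have "decseq (\<lambda>n. \<Prod>i<n. r i)"
    using r by (intro decseq_SucI) (simp add: mult_right_le_one_le mult_left_le)
  then have lim: "(\<lambda>n. \<Prod>i<n. r i) \<longlonglongrightarrow> (INF n. \<Prod>i<n. r i)"
    by (rule LIMSEQ_INF)
  have "(INF n. \<Prod>i<n. r i) \<le> (\<Prod>i<0. r i)"
    by (rule INF_lower) auto
  then have "(INF n. \<Prod>i<n. r i) < \<infinity>"
    using le_less_trans[OF _ ennreal_one_less_top] by auto
  with lim have "prod_finite r"
    by (rule prod_finiteI)
  from prod_finite_mult(1)[OF d(1) this] show ?thesis
    by (simp flip: r(1))
qed

lemma prod_finite_inverse:
  assumes c: "prod_finite c" "\<And>i. c i < \<infinity>" and pos: "0 < infprod c"
  shows "prod_finite (\<lambda>i. inverse (c i))"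
proof -
  have "(\<Prod>i<n. c i) < top" for n
    by (induction n) (use c(2) in \<open>auto simp: ennreal_mult_less_top\<close>)
  then have "(\<Prod>i<n. inverse (c i)) = inverse (\<Prod>i<n. c i)" for n
    by (induction n) (use c(2) in \<open>auto simp: ennreal_inverse_mult\<close>)
  moreover have "(\<lambda>n. inverse (\<Prod>i<n. c i)) \<longlonglongrightarrow> inverse (infprod c)"
    using continuous_on_tendsto_compose[OF continuous_on_inverse_ennreal[OF continuous_on_id] prod_finite_LIMSEQ[OF c(1)], of UNIV]
    by simp
  ultimately show ?thesis
    using pos by (intro prod_finiteI(1)[where L = "inverse (infprod c)"]) (auto simp: less_top[symmetric])
qed

lemma conj_exp_gt_0: "1 < r \<Longrightarrow> 0 < conj_exp r"
  by (simp add: conj_exp_def)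

text \<open>The conjugate exponent is the inverse of 1 - 1/p_i. Summability of 1/p_i makes the
  product of these nonzero factors converge to a nonzero limit, so the product of the inverses
  converges as well.\<close>

lemma prod_finite_conj_exp:
  assumes ps: "\<And>i. 1 < ps i" and "summable (\<lambda>i. 1 / ps i)"
  shows "prod_finite (\<lambda>i. ennreal (conj_exp (ps i)))"
proof -
  have "convergent_prod (\<lambda>i. 1 + (- (1 / ps i)))"
    using assms less_imp_neq[OF ps] less_trans[OF zero_less_one ps]
    by (intro summable_imp_convergent_prod_real) (auto simp: field_simps abs_of_pos)
  then have "convergent_prod (\<lambda>i. inverse (1 + (- (1 / ps i))))"
    by (simp only: convergent_prod_inverse_iff)
  moreover have "inverse (1 + (- (1 / ps i))) = conj_exp (ps i)" for i
    using ps[of i] by (simp add: conj_exp_def field_simps)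
  ultimately have "convergent_prod (\<lambda>i. conj_exp (ps i))"
    by (simp only:)
  then have "(\<lambda>n. \<Prod>i<Suc n. conj_exp (ps i)) \<longlonglongrightarrow> (\<Prod>i. conj_exp (ps i))"
    unfolding lessThan_Suc_atMost by (rule convergent_prod_LIMSEQ)
  then have "(\<lambda>n. ennreal (\<Prod>i<n. conj_exp (ps i))) \<longlonglongrightarrow> ennreal (\<Prod>i. conj_exp (ps i))"
    by (intro tendsto_ennrealI) (simp only: filterlim_sequentially_Suc[where f = "\<lambda>n. \<Prod>i<n. conj_exp (ps i)"])
  then have "(\<lambda>n. \<Prod>i<n. ennreal (conj_exp (ps i))) \<longlonglongrightarrow> ennreal (\<Prod>i. conj_exp (ps i))"
    using ps by (subst prod_ennreal) (auto intro: less_imp_le conj_exp_gt_0)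
  then show ?thesis
    by (rule prod_finiteI) simp
qed

section \<open>Dyadic cubes\<close>

lemma mem_dyadic_cube_iff: "x \<in> dyadic_cube k m \<longleftrightarrow> (\<forall>j. \<lfloor>2 powi k * x $ j\<rfloor> = m $ j)"
proof -
  have "2 powi (-k) * of_int i \<le> (y::real) \<and> y < 2 powi (-k) * (of_int i + 1) \<longleftrightarrow> \<lfloor>2 powi k * y\<rfloor> = i" for y i
    by (auto simp: floor_eq_iff power_int_minus field_simps)
  then show ?thesis
    by (simp add: dyadic_cube_def)
qed

text \<open>The integer index of a point at the coarse level is the quotient of its index at the
  fine level by 2^(l-k). Points with equal fine indices therefore have equal coarse indices.\<close>

lemma dyadic_cube_subset:
  assumes "k \<le> l" "x \<in> dyadic_cube k m" "x \<in> dyadic_cube l m'"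
  shows "dyadic_cube l m' \<subseteq> dyadic_cube k m"
proof
  fix y assume y: "y \<in> dyadic_cube l m'"
  have floor: "\<lfloor>2 powi k * z\<rfloor> = \<lfloor>2 powi l * z\<rfloor> div 2 ^ nat (l - k)" for z :: real
  proof -
    have "(2::real) powi l = 2 powi k * 2 powi (l - k)"
      by (simp flip: power_int_add)
    also have "(2::real) powi (l - k) = 2 ^ nat (l - k)"
      using assms(1) by (simp add: power_int_def)
    finally have "2 powi k * z = 2 powi l * z / of_int (2 ^ nat (l - k))"
      by (simp add: field_simps)
    then show ?thesis
      by (metis floor_divide_real_eq_div zero_le_numeral zero_le_power)
  qed
  show "y \<in> dyadic_cube k m"
    using assms(2,3) y unfolding mem_dyadic_cube_iff floor by simp
qed

lemma dyadic_nested: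
  assumes "B \<in> dyadic" "C \<in> dyadic"
  shows "B \<subseteq> C \<or> C \<subseteq> B \<or> B \<inter> C = {}"
proof -
  obtain k m l m' where *: "B = dyadic_cube k m" "C = dyadic_cube l m'"
    using assms by (auto simp: dyadic_def dyadic_level_def)
  show ?thesis
    using dyadic_cube_subset[of k l _ m m'] dyadic_cube_subset[of l k _ m' m] unfolding *
    by (cases "k \<le> l") (blast, force)
qed

lemma countable_dyadic: "countable (dyadic :: (real^'n) set set)"
  unfolding dyadic_def dyadic_level_def by (intro countable_UN countable_image) auto

lemma dyadic_measure:
  fixes B :: "(real^'n) set"
  assumes "B \<in> dyadic"
  shows "B \<in> sets lebesgue" "emeasure lebesgue B \<noteq> 0"
proof -
  obtain k m where B: "B = dyadic_cube k m"
    using assms by (auto simp: dyadic_def dyadic_level_def)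
  define l u :: "real^'n" where "l = (\<chi> j. 2 powi (-k) * of_int (m $ j))"
    and "u = (\<chi> j. 2 powi (-k) * (of_int (m $ j) + 1))"
  have "{x::real^'n. \<forall>j. l $ j \<le> x $ j \<and> x $ j < u $ j} \<in> sets borel"
    by measurable
  then show sets: "B \<in> sets lebesgue"
    by (auto simp: B dyadic_cube_def l_def u_def)
  have "(0::real) < 2 powi (-k)"
    by simp
  then have "0 < emeasure lebesgue (box l u)"
    by (auto simp: emeasure_lborel_box_eq l_def u_def cart_eq_inner_axis[symmetric] Basis_vec_def algebra_simps intro!: prod_pos)
  also have "\<dots> \<le> emeasure lebesgue B"
    using sets by (intro emeasure_mono) (auto simp: B dyadic_cube_def l_def u_def mem_box_cart intro: less_imp_le)
  finally show "emeasure lebesgue B \<noteq> 0"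
    by auto
qed

section \<open>Laminar families\<close>

text \<open>The nesting property of dyadic cubes, isolated so that the maximal inequalities can be
  proved for any measure and any such family.\<close>

definition laminar :: "'a set set \<Rightarrow> bool" where
  "laminar F \<longleftrightarrow> (\<forall>B\<in>F. \<forall>C\<in>F. B \<subseteq> C \<or> C \<subseteq> B \<or> B \<inter> C = {})"

lemma laminar_subset: "laminar F \<Longrightarrow> G \<subseteq> F \<Longrightarrow> laminar G"
  unfolding laminar_def by (meson subsetD)

lemma laminar_maximal:
  assumes "laminar F" "finite F"
  obtains G where "G \<subseteq> F" "disjoint_family_on (\<lambda>B. B) G" "\<And>B. B \<in> F \<Longrightarrow> \<exists>C\<in>G. B \<subseteq> C"
proof
  let ?G = "{B\<in>F. \<forall>C\<in>F. B \<subseteq> C \<longrightarrow> B = C}"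
  show "?G \<subseteq> F"
    by auto
  show "disjoint_family_on (\<lambda>B. B) ?G"
    unfolding disjoint_family_on_def
  proof (intro ballI impI)
    fix B C assume "B \<in> ?G" "C \<in> ?G" "B \<noteq> C"
    moreover from this have "B \<subseteq> C \<or> C \<subseteq> B \<or> B \<inter> C = {}"
      using assms(1) by (simp add: laminar_def)
    ultimately show "B \<inter> C = {}"
      by auto
  qed
  show "\<exists>C\<in>?G. B \<subseteq> C" if B: "B \<in> F" for B
  proof -
    obtain C where "C \<in> F" "B \<subseteq> C" "\<forall>D\<in>F. C \<subseteq> D \<longrightarrow> C = D"
      using finite_has_maximal2[OF assms(2) B] by metis
    then show ?thesis
      by (intro bexI[of _ C]) auto
  qed
qed

text \<open>The union is the disjoint union of the maximal members, over which both measures are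
  additive.\<close>

lemma laminar_emeasure_Union_le:
  assumes F: "laminar F" "finite F" "F \<subseteq> sets M" and N: "sets N = sets M"
    and le: "\<And>B. B \<in> F \<Longrightarrow> c * emeasure M B \<le> emeasure N B"
  shows "c * emeasure M (\<Union>F) \<le> emeasure N (\<Union>F)"
proof -
  obtain G where G: "G \<subseteq> F" "disjoint_family_on (\<lambda>B. B) G" "\<And>B. B \<in> F \<Longrightarrow> \<exists>C\<in>G. B \<subseteq> C"
    using laminar_maximal[OF F(1,2)] by metis
  have "finite G"
    using G(1) F(2) by (rule finite_subset)
  have U: "\<Union>F = (\<Union>B\<in>G. B)"
    using G(1,3) by fastforce
  have eq: "emeasure L (\<Union>F) = (\<Sum>B\<in>G. emeasure L B)" if "sets L = sets M" for L
    unfolding U using G F(3) \<open>finite G\<close> that by (intro sum_emeasure[symmetric]) auto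
  show ?thesis
    using G(1) le by (auto simp: eq N sum_distrib_left intro!: sum_mono)
qed

text \<open>Every member lies in some maximal one, so grouping the terms by maximal members loses
  nothing; the packing bound is applied to these and their measures add up by disjointness.\<close>

lemma laminar_sum_le:
  assumes F: "laminar F" "finite F" "F \<subseteq> sets M"
    and le: "\<And>C. C \<in> F \<Longrightarrow> (\<Sum>B | B \<in> F \<and> B \<subseteq> C. a B) \<le> c * emeasure M C"
  shows "(\<Sum>B\<in>F. a B) \<le> c * emeasure M (\<Union>F)"
proof -
  obtain G where G: "G \<subseteq> F" "disjoint_family_on (\<lambda>B. B) G" "\<And>B. B \<in> F \<Longrightarrow> \<exists>C\<in>G. B \<subseteq> C"
    using laminar_maximal[OF F(1,2)] by metis
  have "finite G"
    using G(1) F(2) by (rule finite_subset)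
  have U: "\<Union>F = (\<Union>B\<in>G. B)"
    using G(1,3) by fastforce
  have "(\<Sum>B\<in>F. a B) \<le> (\<Sum>B\<in>F. \<Sum>C\<in>G. if B \<subseteq> C then a B else 0)"
  proof (rule sum_mono)
    fix B assume "B \<in> F"
    then obtain C where "C \<in> G" "B \<subseteq> C"
      using G(3) by blast
    then show "a B \<le> (\<Sum>C\<in>G. if B \<subseteq> C then a B else 0)"
      using member_le_sum[OF \<open>C \<in> G\<close>, of "\<lambda>C. if B \<subseteq> C then a B else 0"] \<open>finite G\<close> by simp
  qed
  also have "\<dots> = (\<Sum>C\<in>G. \<Sum>B | B \<in> F \<and> B \<subseteq> C. a B)"
    unfolding sum.swap[of _ G F] using F(2) by (simp add: sum.If_cases Int_def)
  also have "\<dots> \<le> (\<Sum>C\<in>G. c * emeasure M C)"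
    using G(1) by (intro sum_mono le) auto
  also have "\<dots> = c * emeasure M (\<Union>F)"
    unfolding U sum_distrib_left[symmetric] using G F(3) \<open>finite G\<close>
    by (subst sum_emeasure[symmetric]) auto
  finally show ?thesis .
qed

section \<open>Layer decomposition with finitely many levels\<close>

definition prev :: "real set \<Rightarrow> real \<Rightarrow> real" where
  "prev T t = Max (insert 0 {s\<in>T. s < t})"

lemma prev_bounds:
  assumes "finite T" "0 < t"
  shows "0 \<le> prev T t" "prev T t \<le> t"
  using assms by (auto simp: prev_def)

text \<open>The discrete form of integrating h' over [0, y]: the increments between consecutive
  levels take the place of h'(t) dt in the layer-cake formula.\<close>

lemma sum_prev_telescope:
  fixes h :: "real \<Rightarrow> real"
  assumes "finite T" "\<And>t. t \<in> T \<Longrightarrow> 0 < t" "y \<in> insert 0 T"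
  shows "(\<Sum>t | t \<in> T \<and> t \<le> y. h t - h (prev T t)) = h y - h 0"
  using assms
proof (induction T arbitrary: y rule: finite_linorder_max_induct)
  case empty
  then show ?case by simp
next
  case (insert b T)
  have prev: "prev (insert b T) t = prev T t" if "t \<in> T" for t
  proof -
    have "{s \<in> insert b T. s < t} = {s \<in> T. s < t}"
      using insert.hyps(2) that by auto
    then show ?thesis by (simp add: prev_def)
  qed
  have "b \<notin> T"
    using insert.hyps(2) by auto
  have IH: "(\<Sum>t | t \<in> T \<and> t \<le> y. h t - h (prev (insert b T) t)) = h y - h 0" if "y \<in> insert 0 T" for y
    using insert.IH[of y] insert.prems(1) that prev by auto
  show ?case
  proof (cases "y = b")
    case True
    \<comment> \<open>The level just below the new top level \<open>b\<close>, or 0 if there is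
      none; the induction hypothesis is used at this point.\<close>
    let ?m = "Max (insert 0 T)"
    have m: "?m \<in> insert 0 T"
      using insert.hyps(1) by (intro Max_in) auto
    have m_ge: "t \<le> ?m" if "t \<in> T" for t
      using insert.hyps(1) that by (intro Max_ge) auto
    have "{s \<in> insert b T. s < b} = T"
      using insert.hyps(2) by auto
    then have "prev (insert b T) b = ?m"
      by (simp add: prev_def)
    moreover have "{t. t \<in> insert b T \<and> t \<le> y} = insert b {t. t \<in> T \<and> t \<le> ?m}"
      using True insert.hyps(2) m_ge by (auto intro: less_imp_le)
    ultimately show ?thesis
      using IH[OF m] True insert.hyps(1) \<open>b \<notin> T\<close> by simp
  next
    case False
    then have y: "y \<in> insert 0 T"
      using insert.prems(2) by auto
    then have "y < b"
      using insert.prems(1) insert.hyps(2) by auto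
    then have "{t. t \<in> insert b T \<and> t \<le> y} = {t. t \<in> T \<and> t \<le> y}"
      by auto
    then show ?thesis
      using IH[OF y] by simp
  qed
qed

lemma ennreal_layer_sum:
  fixes h :: "real \<Rightarrow> real"
  assumes T: "finite T" "\<And>t. t \<in> T \<Longrightarrow> 0 < t" and y: "y \<in> insert 0 T"
    and h: "mono_on {0..} h" "h 0 = 0"
  shows "ennreal (h y) = (\<Sum>t\<in>T. ennreal (h t - h (prev T t)) * of_bool (t \<le> y))"
proof -
  have nonneg: "0 \<le> h t - h (prev T t)" if "t \<in> T" for t
    using prev_bounds[OF T(1) T(2)[OF that]] by (auto intro!: mono_onD[OF h(1)])
  have "ennreal (h y) = ennreal (\<Sum>t | t \<in> T \<and> t \<le> y. h t - h (prev T t))"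
    using sum_prev_telescope[OF T y, of h] h(2) by simp
  also have "\<dots> = (\<Sum>t | t \<in> T \<and> t \<le> y. ennreal (h t - h (prev T t)))"
    using nonneg by (subst sum_ennreal) auto
  also have "\<dots> = (\<Sum>t\<in>T. ennreal (h t - h (prev T t)) * of_bool (t \<le> y))"
    using T(1) by (intro sum.mono_neutral_cong_left) auto
  finally show ?thesis .
qed

definition level_max :: "'a set set \<Rightarrow> ('a set \<Rightarrow> real) \<Rightarrow> 'a \<Rightarrow> real" where
  "level_max F v x = Max (insert 0 (v ` {B\<in>F. x \<in> B}))"

definition levels :: "'a set set \<Rightarrow> ('a set \<Rightarrow> real) \<Rightarrow> real set" where
  "levels F v = v ` F - {0}"

text \<open>Kept as a family of sets, so that the laminar lemmas apply to it; for positive t its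
  union is the set where \<open>level_max F v\<close> is at least t.\<close>

definition level_sets :: "'a set set \<Rightarrow> ('a set \<Rightarrow> real) \<Rightarrow> real \<Rightarrow> 'a set set" where
  "level_sets F v t = {B\<in>F. t \<le> v B}"

context
  fixes F :: "'a set set" and v :: "'a set \<Rightarrow> real"
  assumes F: "finite F" and v: "\<And>B. B \<in> F \<Longrightarrow> 0 \<le> v B"
begin

lemma levels: "finite (levels F v)" "t \<in> levels F v \<Longrightarrow> 0 < t"
  using F v by (force simp: levels_def)+

lemma level_max_in_levels: "level_max F v x \<in> insert 0 (levels F v)"
proof -
  have "level_max F v x \<in> insert 0 (v ` {B\<in>F. x \<in> B})"
    unfolding level_max_def using F by (intro Max_in) auto
  then show ?thesis
    by (auto simp: levels_def)
qed

lemma level_max_nonneg: "0 \<le> level_max F v x"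
  unfolding level_max_def using F by (intro Max_ge) auto

lemma ennreal_level_max: "ennreal (level_max F v x) = (SUP B\<in>F. ennreal (v B) * indicator B x)"
proof (rule antisym)
  have "level_max F v x \<in> insert 0 (v ` {B\<in>F. x \<in> B})"
    unfolding level_max_def using F by (intro Max_in) auto
  then show "ennreal (level_max F v x) \<le> (SUP B\<in>F. ennreal (v B) * indicator B x)"
  proof
    assume "level_max F v x \<in> v ` {B\<in>F. x \<in> B}"
    then obtain B where "B \<in> F" "x \<in> B" "level_max F v x = v B"
      by auto
    then show ?thesis
      by (intro SUP_upper2[of B]) auto
  qed simp
  show "(SUP B\<in>F. ennreal (v B) * indicator B x) \<le> ennreal (level_max F v x)"
    unfolding level_max_def using F by (intro SUP_least) (auto simp: indicator_def intro!: ennreal_leI Max_ge)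
qed

lemma ennreal_level_max_layers:
  assumes "mono_on {0..} h" "h 0 = 0"
  shows "ennreal (h (level_max F v x)) =
    (\<Sum>t\<in>levels F v. ennreal (h t - h (prev (levels F v) t)) * indicator (\<Union>(level_sets F v t)) x)"
proof -
  have "(t \<le> level_max F v x) = (x \<in> \<Union>(level_sets F v t))" if "t \<in> levels F v" for t
    using F levels(2)[OF that] unfolding level_max_def by (subst Max_ge_iff) (auto simp: level_sets_def)
  then show ?thesis
    by (subst ennreal_layer_sum[OF levels level_max_in_levels assms]) (auto simp: indicator_def intro!: sum.cong)
qed

text \<open>The density \<open>g\<close> lets one formula serve both sides of the Doob estimate:
  with \<open>g = 1\<close> it gives the norm of the maximal function, with \<open>g = f\<close> the
  pairing of \<open>f\<close> with a power of it.\<close>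

lemma nn_integral_level_max_layers:
  assumes h: "mono_on {0..} h" "h 0 = 0" and "F \<subseteq> sets M" "g \<in> borel_measurable M"
  shows "(\<integral>\<^sup>+x. g x * ennreal (h (level_max F v x)) \<partial>M) =
    (\<Sum>t\<in>levels F v. ennreal (h t - h (prev (levels F v) t)) * emeasure (density M g) (\<Union>(level_sets F v t)))"
proof -
  have [measurable]: "\<Union>(level_sets F v t) \<in> sets M" for t
    using F assms(3) by (intro sets.finite_Union) (auto simp: level_sets_def)
  note [measurable] = assms(4)
  show ?thesis
    by (simp add: ennreal_level_max_layers[OF h] sum_distrib_left nn_integral_sum
        mult.left_commute[of "g _"] nn_integral_cmult emeasure_density)
qed

text \<open>Both sides are split with the same level increments. The packing condition passes to the
  subfamily of each level, because that only removes terms on its left, and there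
  \<open>laminar_sum_le\<close> compares the two sides.\<close>

lemma finite_Carleson_embedding:
  assumes "laminar F" and M: "F \<subseteq> sets M"
    and le: "\<And>C. C \<in> F \<Longrightarrow> (\<Sum>B | B \<in> F \<and> B \<subseteq> C. a B) \<le> c * emeasure M C"
  shows "(\<Sum>B\<in>F. a B * ennreal (v B)) \<le> c * (\<integral>\<^sup>+x. ennreal (level_max F v x) \<partial>M)"
proof -
  let ?T = "levels F v"
  have "(\<Sum>B\<in>F. a B * ennreal (v B)) = (\<Sum>B\<in>F. \<Sum>t\<in>?T. ennreal (t - prev ?T t) * (a B * of_bool (t \<le> v B)))"
  proof (intro sum.cong refl)
    fix B assume "B \<in> F"
    then have "v B \<in> insert 0 ?T"
      by (auto simp: levels_def)
    from ennreal_layer_sum[OF levels this, of "\<lambda>t. t"]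
    have "ennreal (v B) = (\<Sum>t\<in>?T. ennreal (t - prev ?T t) * of_bool (t \<le> v B))"
      by (simp add: mono_on_def)
    then show "a B * ennreal (v B) = (\<Sum>t\<in>?T. ennreal (t - prev ?T t) * (a B * of_bool (t \<le> v B)))"
      by (simp add: sum_distrib_left mult.left_commute)
  qed
  also have "\<dots> = (\<Sum>t\<in>?T. ennreal (t - prev ?T t) * (\<Sum>B\<in>level_sets F v t. a B))"
    unfolding sum.swap[of _ ?T F] sum_distrib_left[symmetric]
    using F by (intro sum.cong arg_cong2[where f = "(*)"] refl sum.mono_neutral_cong_right) (auto simp: level_sets_def)
  also have "\<dots> \<le> (\<Sum>t\<in>?T. ennreal (t - prev ?T t) * (c * emeasure M (\<Union>(level_sets F v t))))"
  proof (intro sum_mono mult_left_mono laminar_sum_le)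
    fix t C assume "C \<in> level_sets F v t"
    then have "C \<in> F"
      by (simp add: level_sets_def)
    have "(\<Sum>B | B \<in> level_sets F v t \<and> B \<subseteq> C. a B) \<le> (\<Sum>B | B \<in> F \<and> B \<subseteq> C. a B)"
      using F by (intro sum_mono2) (auto simp: level_sets_def)
    also note le[OF \<open>C \<in> F\<close>]
    finally show "(\<Sum>B | B \<in> level_sets F v t \<and> B \<subseteq> C. a B) \<le> c * emeasure M C" .
  qed (use assms F in \<open>auto simp: level_sets_def intro: laminar_subset\<close>)
  also have "\<dots> = c * (\<integral>\<^sup>+x. 1 * ennreal (level_max F v x) \<partial>M)"
    using nn_integral_level_max_layers[of "\<lambda>t. t", OF _ _ M, of "\<lambda>_. 1"]
    by (simp add: mono_on_def sum_distrib_left mult.left_commute density_1)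
  finally show ?thesis by simp
qed

end

section \<open>Doob's maximal inequality for laminar families\<close>

lemma powr_diff_le:
  fixes s t q :: real
  assumes "1 < q" "0 \<le> s" "s \<le> t"
  shows "t powr q - s powr q \<le> conj_exp q * (t powr (q - 1) - s powr (q - 1)) * t"
proof -
  \<comment> \<open>The claim is the finite-increment form of d(t^q) = q' t d(t^(q-1)) and the
    source of the sharp constant. It is a rearrangement of Young's inequality for the product of t
    and s^(q-1), since q'/q = q' - 1.\<close>
  have "t * s powr (q - 1) \<le> t powr q / q + (s powr (q - 1)) powr conj_exp q / conj_exp q"
    using assms by (intro Youngs_inequality) (auto simp: conj_exp_def field_simps)
  also have "(s powr (q - 1)) powr conj_exp q = s powr q"
    using assms(1) by (simp add: powr_powr conj_exp_def)
  also have "t powr q = t * t powr (q - 1)"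
    using assms powr_mult_base[of t "q - 1"] by simp
  finally have "conj_exp q * (t * s powr (q - 1)) \<le> conj_exp q * (t * t powr (q - 1) / q + s powr q / conj_exp q)"
    using conj_exp_gt_0[OF assms(1)] by (intro mult_left_mono) auto
  also have "\<dots> = (conj_exp q - 1) * (t * t powr (q - 1)) + s powr q"
    using assms(1) by (simp add: conj_exp_def field_simps)
  also have "\<dots> = conj_exp q * (t * t powr (q - 1)) - t powr q + s powr q"
    using \<open>t powr q = t * t powr (q - 1)\<close> by (simp add: algebra_simps)
  finally show ?thesis
    by (simp add: algebra_simps)
qed

text \<open>With m the maximal function and X the integral of m^q, the layers give X \<le> q' times
  the integral of f m^(q-1). Hoelder bounds this by q' times the norm of f times X^(1/q'), and
  X^(1/q') is cancelled.\<close>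

lemma finite_Doob_inequality:
  assumes F: "finite F" "laminar F" "F \<subseteq> sets M" and fin: "\<And>B. B \<in> F \<Longrightarrow> emeasure M B < \<infinity>"
    and v: "\<And>B. B \<in> F \<Longrightarrow> 0 \<le> v B"
    and f: "f \<in> borel_measurable M" and q: "1 < q"
    and le: "\<And>B. B \<in> F \<Longrightarrow> ennreal (v B) * emeasure M B \<le> (\<integral>\<^sup>+x\<in>B. f x \<partial>M)"
  shows "enn_powr (\<integral>\<^sup>+x. enn_powr (ennreal (level_max F v x)) q \<partial>M) (1 / q) \<le>
    ennreal (conj_exp q) * enn_powr (\<integral>\<^sup>+x. enn_powr (f x) q \<partial>M) (1 / q)"
proof -
  let ?T = "levels F v" and ?U = "\<lambda>t. \<Union>(level_sets F v t)" and ?m = "level_max F v"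
  define X where "X = (\<integral>\<^sup>+x. ennreal (?m x powr q) \<partial>M)"
  have mono: "mono_on {0..} (\<lambda>t. t powr r)" "0 powr r = 0" if "0 \<le> r" for r :: real
    using that by (auto intro!: mono_onI powr_mono2)
  have q0: "0 \<le> q" "0 \<le> q - 1"
    using q by auto
  have X: "X = (\<Sum>t\<in>?T. ennreal (t powr q - prev ?T t powr q) * emeasure M (?U t))"
    unfolding X_def using nn_integral_level_max_layers[where v = v and h = "\<lambda>t. t powr q" and g = "\<lambda>_. 1", OF F(1) v mono[OF q0(1)] F(3)]
    by (simp add: density_1)
  have "emeasure M (?U t) < \<infinity>" for t
  proof -
    have "emeasure M (?U t) \<le> (\<Sum>B\<in>level_sets F v t. emeasure M B)"
      using F emeasure_subadditive_finite[of "level_sets F v t" "\<lambda>B. B" M] by (auto simp: level_sets_def)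
    also have "\<dots> < \<infinity>"
      using F fin by (auto simp: level_sets_def)
    finally show ?thesis .
  qed
  \<comment> \<open>Needed for the cancellation at the end; it holds because finitely many levels
    and sets of finite measure occur.\<close>
  then have "X < \<infinity>"
    unfolding X using levels(1)[OF F(1) v] by (auto simp: ennreal_mult_less_top)
  have "X \<le> (\<Sum>t\<in>?T. ennreal (conj_exp q) * (ennreal (t powr (q - 1) - prev ?T t powr (q - 1)) * emeasure (density M f) (?U t)))"
    unfolding X
  proof (rule sum_mono)
    fix t assume "t \<in> ?T"
    then have t: "0 < t" "0 \<le> prev ?T t" "prev ?T t \<le> t"
      using prev_bounds levels[OF F(1) v] by auto
    \<comment> \<open>The weak-type bound with f integrated over the level set alone; this
      localisation is what lets the layers reassemble to f m^(q-1).\<close>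
    have "ennreal t * emeasure M (?U t) \<le> emeasure (density M f) (?U t)"
    proof (intro laminar_emeasure_Union_le)
      fix B assume "B \<in> level_sets F v t"
      then have "B \<in> F" "t \<le> v B"
        by (auto simp: level_sets_def)
      then have "ennreal t * emeasure M B \<le> ennreal (v B) * emeasure M B"
        by (intro mult_right_mono ennreal_leI) auto
      also note le[OF \<open>B \<in> F\<close>]
      also have "(\<integral>\<^sup>+x\<in>B. f x \<partial>M) = emeasure (density M f) B"
        using F f \<open>B \<in> F\<close> by (subst emeasure_density) auto
      finally show "ennreal t * emeasure M B \<le> emeasure (density M f) B" .
    qed (use F in \<open>auto simp: level_sets_def intro: laminar_subset\<close>)
    note 1 = this
    have "ennreal (t powr q - prev ?T t powr q) \<le> ennreal (conj_exp q * (t powr (q - 1) - prev ?T t powr (q - 1)) * t)"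
      using q t by (intro ennreal_leI powr_diff_le)
    also have "\<dots> = ennreal (conj_exp q) * ennreal (t powr (q - 1) - prev ?T t powr (q - 1)) * ennreal t"
      using q t conj_exp_gt_0[OF q] by (auto simp: ennreal_mult powr_mono2 intro!: mult_nonneg_nonneg)
    finally have "ennreal (t powr q - prev ?T t powr q) * emeasure M (?U t) \<le>
        ennreal (conj_exp q) * ennreal (t powr (q - 1) - prev ?T t powr (q - 1)) * ennreal t * emeasure M (?U t)"
      by (intro mult_right_mono) auto
    also have "\<dots> = ennreal (conj_exp q) * ennreal (t powr (q - 1) - prev ?T t powr (q - 1)) * (ennreal t * emeasure M (?U t))"
      by (simp only: mult.assoc)
    also have "\<dots> \<le> ennreal (conj_exp q) * ennreal (t powr (q - 1) - prev ?T t powr (q - 1)) * emeasure (density M f) (?U t)"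
      by (intro mult_left_mono 1) auto
    finally show "ennreal (t powr q - prev ?T t powr q) * emeasure M (?U t) \<le>
        ennreal (conj_exp q) * (ennreal (t powr (q - 1) - prev ?T t powr (q - 1)) * emeasure (density M f) (?U t))"
      by (simp only: mult.assoc)
  qed
  also have "\<dots> = ennreal (conj_exp q) * (\<integral>\<^sup>+x. f x * ennreal (?m x powr (q - 1)) \<partial>M)"
    using nn_integral_level_max_layers[where v = v and h = "\<lambda>t. t powr (q - 1)", OF F(1) v mono[OF q0(2)] F(3) f]
    by (simp add: sum_distrib_left)
  also have "\<dots> \<le> ennreal (conj_exp q) * (enn_powr (\<integral>\<^sup>+x. enn_powr (f x) q \<partial>M) (1 / q) *
      enn_powr (\<integral>\<^sup>+x. enn_powr (ennreal (?m x powr (q - 1))) (conj_exp q) \<partial>M) (1 / conj_exp q))"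
  proof (intro mult_left_mono nn_integral_Hoelder f)
    have "(\<lambda>x. SUP B\<in>F. ennreal (v B) * indicator B x) \<in> borel_measurable M"
      using F by (intro borel_measurable_SUP) (auto intro: countable_finite)
    then have "(\<lambda>x. enn2real (SUP B\<in>F. ennreal (v B) * indicator B x)) \<in> borel_measurable M"
      by measurable
    then have [measurable]: "?m \<in> borel_measurable M"
      using level_max_nonneg[OF F(1) v] by (simp flip: ennreal_level_max[OF F(1) v])
    show "(\<lambda>x. ennreal (?m x powr (q - 1))) \<in> borel_measurable M"
      by measurable
  qed (use q conj_exp_gt_0[OF q] in \<open>auto simp: conj_exp_def field_simps\<close>)
  also have "(\<integral>\<^sup>+x. enn_powr (ennreal (?m x powr (q - 1))) (conj_exp q) \<partial>M) = X"
    using q by (simp add: X_def enn_powr_ennreal powr_powr conj_exp_def)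
  finally have *: "X \<le> ennreal (conj_exp q) * enn_powr (\<integral>\<^sup>+x. enn_powr (f x) q \<partial>M) (1 / q) * enn_powr X (1 / conj_exp q)"
    by (simp add: mult.assoc)
  have "enn_powr X (1 / q) \<le> ennreal (conj_exp q) * enn_powr (\<integral>\<^sup>+x. enn_powr (f x) q \<partial>M) (1 / q)"
  proof (cases "X = 0")
    case False
    have "1 = 1 / q + 1 / conj_exp q"
      using q by (simp add: conj_exp_def field_simps)
    then have "X = enn_powr X (1 / q) * enn_powr X (1 / conj_exp q)"
      by (metis enn_powr_1 enn_powr_add)
    with * show ?thesis
      using False \<open>X < \<infinity>\<close> ennreal_mult_le_mult_iff[of "enn_powr X (1 / conj_exp q)"]
      by (metis enn_powr_eq_0_iff enn_powr_eq_top_iff infinity_ennreal_def less_irrefl mult.commute)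
  qed simp
  then show ?thesis
    using level_max_nonneg[OF F(1) v] by (simp add: X_def enn_powr_ennreal)
qed

text \<open>Hoelder against the indicator of B. It serves to show that single averages are finite
  and that infinite products of averages converge.\<close>

lemma average_le_Lp:
  assumes [measurable]: "B \<in> sets M" "f \<in> borel_measurable M"
    and B: "emeasure M B \<noteq> 0" "emeasure M B < \<infinity>" and q: "1 < q"
  shows "inverse (emeasure M B) * (\<integral>\<^sup>+x\<in>B. f x \<partial>M) \<le>
    enn_powr (\<integral>\<^sup>+x. enn_powr (f x) q \<partial>M) (1 / q) * inverse (enn_powr (emeasure M B) (1 / q))"
proof -
  let ?N = "enn_powr (\<integral>\<^sup>+x. enn_powr (f x) q \<partial>M) (1 / q)" and ?b = "emeasure M B"
  have "1 / q + 1 / conj_exp q = 1"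
    using q by (simp add: conj_exp_def field_simps)
  then have b: "?b = enn_powr ?b (1 / q) * enn_powr ?b (1 / conj_exp q)"
    by (metis enn_powr_1 enn_powr_add)
  have "inverse ?b = inverse (enn_powr ?b (1 / q) * enn_powr ?b (1 / conj_exp q))"
    using b by (rule arg_cong)
  also have "\<dots> = inverse (enn_powr ?b (1 / q)) * inverse (enn_powr ?b (1 / conj_exp q))"
    using B by (intro ennreal_inverse_mult) auto
  finally have inv: "inverse ?b = inverse (enn_powr ?b (1 / q)) * inverse (enn_powr ?b (1 / conj_exp q))" .
  have "(\<integral>\<^sup>+x\<in>B. f x \<partial>M) \<le> ?N * enn_powr (\<integral>\<^sup>+x. enn_powr (indicator B x) (conj_exp q) \<partial>M) (1 / conj_exp q)"
    using q conj_exp_gt_0[OF q] \<open>1 / q + 1 / conj_exp q = 1\<close> by (intro nn_integral_Hoelder) auto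
  also have "(\<lambda>x. enn_powr (indicator B x) (conj_exp q)) = indicator B"
    by (auto simp: indicator_def)
  finally have "inverse ?b * (\<integral>\<^sup>+x\<in>B. f x \<partial>M) \<le> inverse ?b * (?N * enn_powr ?b (1 / conj_exp q))"
    by (intro mult_left_mono) auto
  also have "inverse ?b * (?N * enn_powr ?b (1 / conj_exp q)) =
      ?N * inverse (enn_powr ?b (1 / q)) * (inverse (enn_powr ?b (1 / conj_exp q)) * enn_powr ?b (1 / conj_exp q))"
    unfolding inv by (simp only: ac_simps)
  also have "inverse (enn_powr ?b (1 / conj_exp q)) * enn_powr ?b (1 / conj_exp q) = 1"
    using B by (intro ennreal_inverse_mult_cancel) auto
  finally show ?thesis by simp
qed

text \<open>The constant depends on q only, so the bound for the first n members of an enumeration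
  passes to all of D by monotone convergence.\<close>

lemma laminar_maximal_inequality:
  assumes D: "countable D" "laminar D" "D \<subseteq> sets M"
    and B: "\<And>B. B \<in> D \<Longrightarrow> emeasure M B \<noteq> 0" "\<And>B. B \<in> D \<Longrightarrow> emeasure M B < \<infinity>"
    and f [measurable]: "f \<in> borel_measurable M" and q: "1 < q"
  shows "enn_powr (\<integral>\<^sup>+x. enn_powr (SUP B\<in>{B\<in>D. x \<in> B}. inverse (emeasure M B) * (\<integral>\<^sup>+y\<in>B. f y \<partial>M)) q \<partial>M) (1 / q)
    \<le> ennreal (conj_exp q) * enn_powr (\<integral>\<^sup>+x. enn_powr (f x) q \<partial>M) (1 / q)" (is "?L \<le> ?R")
\<comment> \<open>In the remaining case D can be enumerated, and a finite norm of \<open>f\<close>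
  makes all averages finite, so that they can serve as real values \<open>v\<close>.\<close>
proof (cases "D = {} \<or> (\<integral>\<^sup>+x. enn_powr (f x) q \<partial>M) = top")
  case True
  then show ?thesis
    using conj_exp_gt_0[OF q] by (auto simp: ennreal_mult_top bot_ennreal)
next
  case False
  define a where "a B = inverse (emeasure M B) * (\<integral>\<^sup>+y\<in>B. f y \<partial>M)" for B
  define v where "v B = enn2real (a B)" for B
  have "a B < \<infinity>" if "B \<in> D" for B
  proof -
    have "a B \<le> enn_powr (\<integral>\<^sup>+x. enn_powr (f x) q \<partial>M) (1 / q) * inverse (enn_powr (emeasure M B) (1 / q))"
      unfolding a_def using D B that q by (intro average_le_Lp) auto
    also have "\<dots> < \<infinity>"
      using B(1)[OF that] False by (auto simp: ennreal_mult_eq_top_iff less_top[symmetric])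
    finally show ?thesis .
  qed
  then have v: "ennreal (v B) = a B" if "B \<in> D" for B
    using that by (auto simp: v_def)
  define e where "e = from_nat_into D"
  have e: "range e = D"
    using D(1) False by (auto simp: e_def range_from_nat_into)
  define F where "F n = e ` {..<n}" for n :: nat
  have F: "finite (F n)" "F n \<subseteq> D" for n
    using e by (auto simp: F_def)
  have v0: "0 \<le> v B" for B
    by (simp add: v_def)
  have m: "ennreal (level_max (F n) v x) = (SUP B\<in>F n. a B * indicator B x)" for n x
    unfolding ennreal_level_max[OF F(1) v0] using F(2) v by (intro SUP_cong) (auto simp: subset_iff)
  have SUP: "(SUP B\<in>{B\<in>D. x \<in> B}. a B) = (SUP n. ennreal (level_max (F n) v x))" for x
  proof (rule antisym)
    show "(SUP B\<in>{B\<in>D. x \<in> B}. a B) \<le> (SUP n. ennreal (level_max (F n) v x))"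
    proof (rule SUP_least)
      fix B assume "B \<in> {B\<in>D. x \<in> B}"
      moreover from this obtain n where "B = e n"
        using e by auto
      ultimately show "a B \<le> (SUP n. ennreal (level_max (F n) v x))"
        unfolding m by (intro SUP_upper2[of "Suc n"] SUP_upper2[of B]) (auto simp: F_def)
    qed
    show "(SUP n. ennreal (level_max (F n) v x)) \<le> (SUP B\<in>{B\<in>D. x \<in> B}. a B)"
      unfolding m
    proof (intro SUP_least)
      fix n B assume "B \<in> F n"
      then show "a B * indicator B x \<le> (SUP B\<in>{B\<in>D. x \<in> B}. a B)"
        using F(2)[of n] by (cases "x \<in> B") (auto intro!: SUP_upper)
    qed
  qed
  have [measurable]: "(\<lambda>x. ennreal (level_max (F n) v x)) \<in> borel_measurable M" for n
    unfolding m using F D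
    by (intro borel_measurable_SUP borel_measurable_times_ennreal borel_measurable_const borel_measurable_indicator)
      (auto intro: countable_finite)
  have "incseq (\<lambda>n x. enn_powr (ennreal (level_max (F n) v x)) q)"
    unfolding m using q by (auto simp: incseq_def le_fun_def F_def intro!: enn_powr_mono SUP_subset_mono)
  then have "?L = enn_powr (SUP n. \<integral>\<^sup>+x. enn_powr (ennreal (level_max (F n) v x)) q \<partial>M) (1 / q)"
    unfolding a_def[symmetric] SUP using q
    by (subst enn_powr_SUP) (auto intro!: arg_cong2[where f = enn_powr] nn_integral_monotone_convergence_SUP)
  also have "\<dots> = (SUP n. enn_powr (\<integral>\<^sup>+x. enn_powr (ennreal (level_max (F n) v x)) q \<partial>M) (1 / q))"
    using q by (intro enn_powr_SUP) auto
  also have "\<dots> \<le> ?R"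
  proof (intro SUP_least finite_Doob_inequality F v0 f q)
    fix n B assume "B \<in> F n"
    then have "B \<in> D"
      using F by auto
    then show "emeasure M B < \<infinity>"
      by (rule B)
    have "ennreal (v B) * emeasure M B = inverse (emeasure M B) * emeasure M B * (\<integral>\<^sup>+y\<in>B. f y \<partial>M)"
      unfolding v[OF \<open>B \<in> D\<close>] a_def by (simp only: ac_simps)
    also have "inverse (emeasure M B) * emeasure M B = 1"
      using B[OF \<open>B \<in> D\<close>] by (intro ennreal_inverse_mult_cancel) auto
    finally show "ennreal (v B) * emeasure M B \<le> (\<integral>\<^sup>+x\<in>B. f x \<partial>M)"
      by simp
  qed (use F D in \<open>auto intro: laminar_subset\<close>)
  finally show ?thesis .
qed

lemma sigma_finite_lebesgue: "sigma_finite_measure (lebesgue :: 'a::euclidean_space measure)"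
proof
  obtain A :: "'a set set" where A: "countable A" "A \<subseteq> sets lborel" "\<Union>A = space lborel" "\<forall>a\<in>A. emeasure lborel a \<noteq> \<infinity>"
    using lborel.sigma_finite_countable by auto
  then show "\<exists>A :: 'a set set. countable A \<and> A \<subseteq> sets lebesgue \<and> \<Union>A = space lebesgue \<and> (\<forall>a\<in>A. emeasure lebesgue a \<noteq> \<infinity>)"
    by (intro exI[of _ A]) auto
qed

section \<open>Sequences of weights\<close>

text \<open>The last two assumptions express that the functions \<sigma>_i \<chi>_B belong to the
  product of the spaces L^(p_i)(\<omega>_i): the i-th norm is \<sigma>_i(B)^(1/p_i).\<close>

locale weight_sequence =
  fixes ps :: "nat \<Rightarrow> real" and p :: real and \<sigma> :: "nat \<Rightarrow> real^'n \<Rightarrow> real"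
  assumes ps: "\<And>i. 1 < ps i"
    and sums: "(\<lambda>i. 1 / ps i) sums (1 / p)"
    and \<sigma>_measurable [measurable]: "\<And>i. \<sigma> i \<in> borel_measurable lebesgue"
    and \<sigma>_nonneg: "\<And>i x. 0 \<le> \<sigma> i x"
    and \<sigma>_pos: "\<And>i. AE x in lebesgue. 0 < \<sigma> i x"
    and \<sigma>_prod: "AE x in lebesgue. prod_converges (\<lambda>i. ennreal (\<sigma> i x powr (1 / ps i))) \<and>
                       0 < infprod (\<lambda>i. ennreal (\<sigma> i x powr (1 / ps i)))"
    and \<sigma>_finite: "\<And>i B. B \<in> dyadic \<Longrightarrow> (\<integral>\<^sup>+x\<in>B. ennreal (\<sigma> i x) \<partial>lebesgue) < \<infinity>"
    and \<sigma>_prod_finite: "\<And>B. B \<in> dyadic \<Longrightarrow>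
      prod_finite (\<lambda>i. enn_powr (\<integral>\<^sup>+x\<in>B. ennreal (\<sigma> i x) \<partial>lebesgue) (1 / ps i))"
begin

abbreviation \<mu> :: "nat \<Rightarrow> (real^'n) measure" where
  "\<mu> i \<equiv> density lebesgue (\<lambda>x. ennreal (\<sigma> i x))"

lemma p_pos: "0 < p"
proof -
  have "0 < (\<Sum>i. 1 / ps i)"
    using sums ps by (intro suminf_pos) (auto simp: sums_iff intro: less_trans[OF zero_less_one])
  then show ?thesis
    using sums by (simp add: sums_iff)
qed

lemma ps_pos: "0 < ps i"
  using ps[of i] by simp

lemma exponents: "0 < p / ps i" "(\<lambda>i. p / ps i) sums 1"
  using sums_mult[OF sums, of p] p_pos ps_pos[of i] by simp_all

lemma enn_powr_\<sigma>: "enn_powr (ennreal (\<sigma> i x)) r = ennreal (\<sigma> i x powr r)"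
  by (simp add: enn_powr_ennreal \<sigma>_nonneg)

text \<open>Positivity is assumed for the exponents 1/p_i; continuity of the p-th power carries it
  over to p/p_i. The limit may be infinite.\<close>

lemma nu_LIMSEQ:
  "AE x in lebesgue. (\<lambda>n. \<Prod>i<n. enn_powr (ennreal (\<sigma> i x)) (p / ps i)) \<longlonglongrightarrow> nu p ps \<sigma> x \<and> 0 < nu p ps \<sigma> x"
  using \<sigma>_prod
proof eventually_elim
  case (elim x)
  have "(\<lambda>n. enn_powr (\<Prod>i<n. ennreal (\<sigma> i x powr (1 / ps i))) p) \<longlonglongrightarrow> enn_powr (infprod (\<lambda>i. ennreal (\<sigma> i x powr (1 / ps i)))) p"
    using elim p_pos by (intro tendsto_enn_powr prod_converges_LIMSEQ) auto
  also have "(\<lambda>n. enn_powr (\<Prod>i<n. ennreal (\<sigma> i x powr (1 / ps i))) p) = (\<lambda>n. \<Prod>i<n. ennreal (\<sigma> i x powr (p / ps i)))"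
    by (simp add: enn_powr_prod enn_powr_ennreal powr_powr)
  finally have *: "(\<lambda>n. \<Prod>i<n. ennreal (\<sigma> i x powr (p / ps i))) \<longlonglongrightarrow> enn_powr (infprod (\<lambda>i. ennreal (\<sigma> i x powr (1 / ps i)))) p" .
  moreover have "nu p ps \<sigma> x = enn_powr (infprod (\<lambda>i. ennreal (\<sigma> i x powr (1 / ps i)))) p"
    using limI[OF *] by (simp add: nu_def infprod_def)
  ultimately show ?case
    using elim by (auto simp: enn_powr_\<sigma> zero_less_iff_neq_zero)
qed

text \<open>\<open>nu\<close> is unspecified where the partial products diverge. The liminf is
  measurable by construction and agrees with it off a null set, so it can serve as a
  density.\<close>

lemma nu_measurable_version:
  obtains w where "w \<in> borel_measurable lebesgue" "AE x in lebesgue. w x = nu p ps \<sigma> x"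
proof
  show "(\<lambda>x. liminf (\<lambda>n. \<Prod>i<n. enn_powr (ennreal (\<sigma> i x)) (p / ps i))) \<in> borel_measurable lebesgue"
    by measurable
  show "AE x in lebesgue. liminf (\<lambda>n. \<Prod>i<n. enn_powr (ennreal (\<sigma> i x)) (p / ps i)) = nu p ps \<sigma> x"
    using nu_LIMSEQ by eventually_elim (simp add: lim_imp_Liminf)
qed

lemma \<mu>_dyadic:
  assumes "B \<in> dyadic"
  shows "B \<in> sets (\<mu> i)" "emeasure (\<mu> i) B = (\<integral>\<^sup>+x\<in>B. ennreal (\<sigma> i x) \<partial>lebesgue)"
    "emeasure (\<mu> i) B \<noteq> 0" "emeasure (\<mu> i) B < \<infinity>"
proof -
  note [measurable] = dyadic_measure(1)[OF assms]
  show "B \<in> sets (\<mu> i)"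
    by simp
  show *: "emeasure (\<mu> i) B = (\<integral>\<^sup>+x\<in>B. ennreal (\<sigma> i x) \<partial>lebesgue)"
    by (simp add: emeasure_density)
  then show "emeasure (\<mu> i) B < \<infinity>"
    using \<sigma>_finite[OF assms] by simp
  show "emeasure (\<mu> i) B \<noteq> 0"
  proof
    assume "emeasure (\<mu> i) B = 0"
    then have "AE x in lebesgue. ennreal (\<sigma> i x) * indicator B x = 0"
      unfolding * by (subst (asm) nn_integral_0_iff_AE) measurable
    then have "AE x in lebesgue. x \<notin> B"
      using \<sigma>_pos[of i] by eventually_elim (auto simp: indicator_def)
    then have "emeasure lebesgue B = 0"
      using AE_iff_measurable[of B lebesgue "\<lambda>x. x \<notin> B"] by auto
    with dyadic_measure(2)[OF assms] show False
      by simp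
  qed
qed

text \<open>Infinite Hoelder with the exponents p/p_i, which sum to 1. It is used for g_i =
  \<sigma>_i \<chi>_B, to see that the product of the cube masses is positive, and for g_i =
  \<sigma>_i m_i^(p_i) with the single-weight maximal functions m_i.\<close>

lemma nn_integral_liminf_prod_le:
  assumes [measurable]: "\<And>i. g i \<in> borel_measurable lebesgue"
    and le: "\<And>i. enn_powr (\<integral>\<^sup>+x. g i x \<partial>lebesgue) (1 / ps i) \<le> e i" and e: "prod_finite e"
  shows "(\<integral>\<^sup>+x. liminf (\<lambda>n. \<Prod>i<n. enn_powr (g i x) (p / ps i)) \<partial>lebesgue) \<le> enn_powr (infprod e) p"
proof (rule nn_integral_Hoelder_infinite_prod)
  fix n
  have "(\<Prod>i<n. enn_powr (\<integral>\<^sup>+x. g i x \<partial>lebesgue) (p / ps i)) = enn_powr (\<Prod>i<n. enn_powr (\<integral>\<^sup>+x. g i x \<partial>lebesgue) (1 / ps i)) p"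
    by (simp add: enn_powr_prod enn_powr_powr)
  also have "\<dots> \<le> enn_powr (\<Prod>i<n. e i) p"
    using p_pos le by (intro enn_powr_mono prod_mono_ennreal) auto
  finally show "(\<Prod>i<n. enn_powr (\<integral>\<^sup>+x. g i x \<partial>lebesgue) (p / ps i)) \<le> enn_powr (\<Prod>i<n. e i) p" .
next
  show "(\<lambda>n. enn_powr (\<Prod>i<n. e i) p) \<longlonglongrightarrow> enn_powr (infprod e) p"
    using p_pos e by (intro tendsto_enn_powr prod_finite_LIMSEQ)
  show "sigma_finite_measure lebesgue"
    by (rule sigma_finite_lebesgue)
qed (use exponents in auto)

text \<open>Hoelder bounds the power p of the product from below by the integral of the positive
  function \<^term>\<open>nu p ps \<sigma>\<close> over the cube.\<close>
lemma infprod_\<mu>_pos: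
  assumes "B \<in> dyadic"
  shows "0 < infprod (\<lambda>i. enn_powr (emeasure (\<mu> i) B) (1 / ps i))"
proof (rule ccontr)
  note [measurable] = dyadic_measure(1)[OF assms]
  let ?P = "\<lambda>x. liminf (\<lambda>n. \<Prod>i<n. enn_powr (ennreal (\<sigma> i x) * indicator B x) (p / ps i))"
  assume "\<not> 0 < infprod (\<lambda>i. enn_powr (emeasure (\<mu> i) B) (1 / ps i))"
  then have "(\<integral>\<^sup>+x. ?P x \<partial>lebesgue) \<le> 0"
    using nn_integral_liminf_prod_le[of "\<lambda>i x. ennreal (\<sigma> i x) * indicator B x", OF _ order.refl \<sigma>_prod_finite[OF assms]]
    by (simp add: \<mu>_dyadic(2)[OF assms])
  then have "AE x in lebesgue. ?P x = 0"
    by (subst nn_integral_0_iff_AE[symmetric]) auto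
  then have "AE x in lebesgue. x \<notin> B"
    using nu_LIMSEQ by eventually_elim (auto simp: lim_imp_Liminf)
  then have "emeasure lebesgue B = 0"
    using AE_iff_measurable[of B lebesgue "\<lambda>x. x \<notin> B"] by auto
  with dyadic_measure(2)[OF assms] show False
    by simp
qed

section \<open>The two inequalities for a fixed sequence of functions\<close>

context
  fixes f :: "nat \<Rightarrow> real^'n \<Rightarrow> real"
  assumes f: "in_prod_Lp ps \<sigma> f"
begin

lemma f_measurable [measurable]: "f i \<in> borel_measurable lebesgue"
  using f by (simp add: in_prod_Lp_def)

lemma Lp_norm_f:
  "real_Lp_norm (ps i) (\<sigma> i) (f i) = enn_powr (\<integral>\<^sup>+x. enn_powr (ennreal (f i x)) (ps i) \<partial>\<mu> i) (1 / ps i)"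
  using f by (simp add: in_prod_Lp_def Lp_norm_def nn_integral_density mult.commute)

lemma waverage_\<mu>:
  assumes "B \<in> dyadic"
  shows "waverage (\<sigma> i) B (f i) = inverse (emeasure (\<mu> i) B) * (\<integral>\<^sup>+x\<in>B. ennreal (f i x) \<partial>\<mu> i)"
proof -
  note [measurable] = dyadic_measure(1)[OF assms]
  show ?thesis
    using f by (simp add: waverage_def \<mu>_dyadic[OF assms] divide_ennreal_def nn_integral_density
        in_prod_Lp_def ennreal_mult' \<sigma>_nonneg mult.left_commute mult.commute)
qed

text \<open>The averages are dominated by norms times inverse powers of the cube masses. The product
  of the norms converges by assumption; that of the inverses does because
  \<open>infprod_\<mu>_pos\<close> excludes the limit 0.\<close>

lemma prod_finite_waverage:
  assumes B: "B \<in> dyadic"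
  shows "prod_finite (\<lambda>i. waverage (\<sigma> i) B (f i))"
proof (rule prod_finite_le)
  let ?d = "\<lambda>i. real_Lp_norm (ps i) (\<sigma> i) (f i) * inverse (enn_powr (emeasure (\<mu> i) B) (1 / ps i))"
  show "prod_finite ?d"
    using f \<sigma>_prod_finite[OF B] infprod_\<mu>_pos[OF B] \<mu>_dyadic[OF B]
    by (intro prod_finite_mult prod_finite_inverse) (auto simp: in_prod_Lp_def)
  show "?d i < \<infinity>" for i
  proof -
    have "real_Lp_norm (ps i) (\<sigma> i) (f i) < \<infinity>"
      using f unfolding in_prod_Lp_def by blast
    then show ?thesis
      using \<mu>_dyadic(3)[OF B, of i] by (auto simp: ennreal_mult_eq_top_iff less_top[symmetric])
  qed
  show "waverage (\<sigma> i) B (f i) \<le> ?d i" for i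
    unfolding waverage_\<mu>[OF B] Lp_norm_f using \<mu>_dyadic[OF B] ps by (intro average_le_Lp) auto
qed

lemma Carleson_embedding:
  assumes a: "\<And>B. B \<in> dyadic \<Longrightarrow> 0 \<le> a B" and A: "0 < A"
    and carleson: "\<And>G. G \<in> dyadic \<Longrightarrow>
      (\<Sum>\<^sub>\<infinity>B\<in>{B\<in>dyadic. B \<subseteq> G}. ennreal (a B)) \<le> ennreal A * (\<integral>\<^sup>+x\<in>G. nu p ps \<sigma> x \<partial>lebesgue)"
  shows "(\<Sum>\<^sub>\<infinity>B\<in>dyadic. ennreal (a B) * enn_powr (infprod (\<lambda>i. waverage (\<sigma> i) B (f i))) p)
    \<le> ennreal A * (\<integral>\<^sup>+x. enn_powr (dyadic_maximal \<sigma> f x) p * nu p ps \<sigma> x \<partial>lebesgue)"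
proof (rule infsum_le_finite_sums)
  fix F :: "(real^'n) set set" assume F: "finite F" "F \<subseteq> dyadic"
  obtain w where w [measurable]: "w \<in> borel_measurable lebesgue" and w_eq: "AE x in lebesgue. w x = nu p ps \<sigma> x"
    by (rule nu_measurable_version)
  define c where "c B = infprod (\<lambda>i. waverage (\<sigma> i) B (f i))" for B
  \<comment> \<open>The p-th power is absorbed into the values, so the embedding is applied to
    layers of p-th powers and no constant is lost. Convergence of the products makes these values
    finite.\<close>
  define v where "v B = enn2real (enn_powr (c B) p)" for B
  have v: "ennreal (v B) = enn_powr (c B) p" if "B \<in> F" for B
    using prod_finite_waverage[of B] F(2) that by (auto simp: v_def c_def prod_finite_def)
  have v0: "0 \<le> v B" for B
    by (simp add: v_def)
  have "(\<Sum>B\<in>F. ennreal (a B) * enn_powr (c B) p) = (\<Sum>B\<in>F. ennreal (a B) * ennreal (v B))"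
    using v by simp
  also have "\<dots> \<le> ennreal A * (\<integral>\<^sup>+x. ennreal (level_max F v x) \<partial>density lebesgue w)"
  proof (rule finite_Carleson_embedding[OF F(1) v0])
    show "laminar F"
      using F(2) dyadic_nested unfolding laminar_def by blast
    show "F \<subseteq> sets (density lebesgue w)"
      using F(2) dyadic_measure(1) by auto
    fix G assume "G \<in> F"
    then have G: "G \<in> dyadic"
      using F(2) by auto
    note [measurable] = dyadic_measure(1)[OF G]
    have "(\<Sum>B | B \<in> F \<and> B \<subseteq> G. ennreal (a B)) \<le> (\<Sum>\<^sub>\<infinity>B\<in>{B\<in>dyadic. B \<subseteq> G}. ennreal (a B))"
      using F by (subst nonneg_infsum_complete) (auto intro!: SUP_upper)
    also note carleson[OF G]
    also have "(\<integral>\<^sup>+x\<in>G. nu p ps \<sigma> x \<partial>lebesgue) = (\<integral>\<^sup>+x\<in>G. w x \<partial>lebesgue)"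
      using w_eq by (intro nn_integral_cong_AE) auto
    also have "\<dots> = emeasure (density lebesgue w) G"
      by (simp add: emeasure_density)
    finally show "(\<Sum>B | B \<in> F \<and> B \<subseteq> G. ennreal (a B)) \<le> ennreal A * emeasure (density lebesgue w) G" .
  qed
  also have "\<dots> \<le> ennreal A * (\<integral>\<^sup>+x. enn_powr (dyadic_maximal \<sigma> f x) p * nu p ps \<sigma> x \<partial>lebesgue)"
  proof (rule mult_left_mono)
    have le: "ennreal (level_max F v x) \<le> enn_powr (dyadic_maximal \<sigma> f x) p" for x
      unfolding ennreal_level_max[OF F(1) v0]
    proof (rule SUP_least)
      fix B assume B: "B \<in> F"
      show "ennreal (v B) * indicator B x \<le> enn_powr (dyadic_maximal \<sigma> f x) p"
      proof (cases "x \<in> B")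
        case True
        then have "c B \<le> dyadic_maximal \<sigma> f x"
          using B F(2) unfolding dyadic_maximal_def c_def by (intro SUP_upper) auto
        then show ?thesis
          using True p_pos by (simp add: v[OF B] enn_powr_mono)
      qed simp
    qed
    have [measurable]: "(\<lambda>x. ennreal (level_max F v x)) \<in> borel_measurable lebesgue"
      unfolding ennreal_level_max[OF F(1) v0] using F dyadic_measure(1)
      by (intro borel_measurable_SUP borel_measurable_times_ennreal borel_measurable_const borel_measurable_indicator)
        (auto intro: countable_finite)
    have "(\<integral>\<^sup>+x. ennreal (level_max F v x) \<partial>density lebesgue w) = (\<integral>\<^sup>+x. w x * ennreal (level_max F v x) \<partial>lebesgue)"
      by (simp add: nn_integral_density)
    also have "\<dots> \<le> (\<integral>\<^sup>+x. enn_powr (dyadic_maximal \<sigma> f x) p * nu p ps \<sigma> x \<partial>lebesgue)"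
      using w_eq by (intro nn_integral_mono_AE) (auto simp: mult.commute[of "nu p ps \<sigma> _"] intro!: mult_right_mono le elim!: eventually_mono)
    finally show "(\<integral>\<^sup>+x. ennreal (level_max F v x) \<partial>density lebesgue w) \<le>
      (\<integral>\<^sup>+x. enn_powr (dyadic_maximal \<sigma> f x) p * nu p ps \<sigma> x \<partial>lebesgue)" .
  qed simp
  finally show "(\<Sum>B\<in>F. ennreal (a B) * enn_powr (infprod (\<lambda>i. waverage (\<sigma> i) B (f i))) p)
    \<le> ennreal A * (\<integral>\<^sup>+x. enn_powr (dyadic_maximal \<sigma> f x) p * nu p ps \<sigma> x \<partial>lebesgue)"
    by (simp add: c_def)
qed (intro nonneg_summable_on_complete zero_le)

lemma prod_finite_conj_norm:
  "prod_finite (\<lambda>i. ennreal (conj_exp (ps i)) * real_Lp_norm (ps i) (\<sigma> i) (f i))"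
  using f ps sums by (intro prod_finite_mult prod_finite_conj_exp) (auto simp: in_prod_Lp_def sums_iff)

text \<open>The weighted averages are plain averages for the measures \<open>\<mu> i\<close>, so
  Doob's inequality applies to each weight with the constant p_i' whatever the weight is; infinite
  Hoelder combines the factors.\<close>

lemma dyadic_maximal_le:
  "Lp_norm p (nu p ps \<sigma>) (dyadic_maximal \<sigma> f)
    \<le> infprod (\<lambda>i. ennreal (conj_exp (ps i)) * real_Lp_norm (ps i) (\<sigma> i) (f i))"
proof -
  let ?e = "\<lambda>i. ennreal (conj_exp (ps i)) * real_Lp_norm (ps i) (\<sigma> i) (f i)"
  define m where "m i x = (SUP B\<in>{B\<in>dyadic. x \<in> B}. waverage (\<sigma> i) B (f i))" for i x
  \<comment> \<open>Chosen so that g_i^(p/p_i) = \<sigma>_i^(p/p_i) m_i^p: the partial products of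
    these dominate those of \<open>nu\<close> times the p-th power of the product of averages over
    any cube containing x.\<close>
  define g where "g i x = ennreal (\<sigma> i x) * enn_powr (m i x) (ps i)" for i x
  have m_eq: "m i x = (SUP B\<in>dyadic. waverage (\<sigma> i) B (f i) * indicator B x)" for i x
  proof (rule antisym)
    show "m i x \<le> (SUP B\<in>dyadic. waverage (\<sigma> i) B (f i) * indicator B x)"
      unfolding m_def by (intro SUP_least) (auto intro!: SUP_upper2)
    show "(SUP B\<in>dyadic. waverage (\<sigma> i) B (f i) * indicator B x) \<le> m i x"
      unfolding m_def by (intro SUP_least) (auto simp: indicator_def intro!: SUP_upper)
  qed
  have [measurable]: "m i \<in> borel_measurable lebesgue" for i
    unfolding m_eq[abs_def] using dyadic_measure(1) countable_dyadic
    by (intro borel_measurable_SUP borel_measurable_times_ennreal borel_measurable_const borel_measurable_indicator) auto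
  have "enn_powr (\<integral>\<^sup>+x. g i x \<partial>lebesgue) (1 / ps i) \<le> ?e i" for i
  proof -
    have "(\<integral>\<^sup>+x. g i x \<partial>lebesgue) = (\<integral>\<^sup>+x. enn_powr (m i x) (ps i) \<partial>\<mu> i)"
      unfolding g_def by (simp add: nn_integral_density)
    also have "m i = (\<lambda>x. SUP B\<in>{B\<in>dyadic. x \<in> B}. inverse (emeasure (\<mu> i) B) * (\<integral>\<^sup>+x\<in>B. ennreal (f i x) \<partial>\<mu> i))"
      unfolding m_def by (intro ext SUP_cong) (auto simp: waverage_\<mu>)
    finally show ?thesis
      unfolding Lp_norm_f using countable_dyadic dyadic_nested \<mu>_dyadic ps
      by (simp only:, intro laminar_maximal_inequality) (auto simp: laminar_def)
  qed
  then have "(\<integral>\<^sup>+x. liminf (\<lambda>n. \<Prod>i<n. enn_powr (g i x) (p / ps i)) \<partial>lebesgue) \<le> enn_powr (infprod ?e) p"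
    by (intro nn_integral_liminf_prod_le prod_finite_conj_norm) (auto simp: g_def)
  moreover have "(\<integral>\<^sup>+x. enn_powr (dyadic_maximal \<sigma> f x) p * nu p ps \<sigma> x \<partial>lebesgue) \<le>
      (\<integral>\<^sup>+x. liminf (\<lambda>n. \<Prod>i<n. enn_powr (g i x) (p / ps i)) \<partial>lebesgue)"
  proof (intro nn_integral_mono_AE, use nu_LIMSEQ in eventually_elim)
    case (elim x)
    show ?case
      unfolding dyadic_maximal_def enn_powr_SUP[OF p_pos] SUP_mult_right_ennreal
    proof (rule SUP_least)
      fix B assume "B \<in> {B \<in> dyadic. x \<in> B}"
      then have B: "B \<in> dyadic" "x \<in> B"
        by auto
      define c where "c i = waverage (\<sigma> i) B (f i)" for i
      note c = prod_finite_waverage[OF B(1), folded c_def]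
      show "enn_powr (infprod (\<lambda>i. waverage (\<sigma> i) B (f i))) p * nu p ps \<sigma> x
          \<le> liminf (\<lambda>n. \<Prod>i<n. enn_powr (g i x) (p / ps i))"
      \<comment> \<open>The limit of the product is the product of the limits unless 0 meets
        \<infinity>, and \<open>nu\<close> may be infinite at x. If the product of averages is 0,
        the left side vanishes.\<close>
      proof (cases "infprod c = 0")
        case False
        have "(\<lambda>n. enn_powr (\<Prod>i<n. c i) p * (\<Prod>i<n. enn_powr (ennreal (\<sigma> i x)) (p / ps i)))
            \<longlonglongrightarrow> enn_powr (infprod c) p * nu p ps \<sigma> x"
          using elim False c p_pos
          by (intro tendsto_mult_ennreal tendsto_enn_powr prod_finite_LIMSEQ) (auto simp: prod_finite_def)
        then have "enn_powr (infprod c) p * nu p ps \<sigma> x =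
            liminf (\<lambda>n. enn_powr (\<Prod>i<n. c i) p * (\<Prod>i<n. enn_powr (ennreal (\<sigma> i x)) (p / ps i)))"
          by (simp add: lim_imp_Liminf)
        also have "\<dots> \<le> liminf (\<lambda>n. \<Prod>i<n. enn_powr (g i x) (p / ps i))"
        proof (intro Liminf_mono always_eventually allI)
          fix n
          have "enn_powr (c i) p * enn_powr (ennreal (\<sigma> i x)) (p / ps i) \<le> enn_powr (g i x) (p / ps i)" for i
          proof -
            have "c i \<le> m i x"
              unfolding c_def m_def using B by (intro SUP_upper) auto
            then show ?thesis
              using p_pos ps_pos[of i] unfolding g_def enn_powr_mult enn_powr_powr
              by (simp add: mult.commute) (intro mult_right_mono enn_powr_mono, auto)
          qed
          then show "enn_powr (\<Prod>i<n. c i) p * (\<Prod>i<n. enn_powr (ennreal (\<sigma> i x)) (p / ps i))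
              \<le> (\<Prod>i<n. enn_powr (g i x) (p / ps i))"
            unfolding enn_powr_prod prod.distrib[symmetric] by (intro prod_mono_ennreal) auto
        qed
        finally show ?thesis
          by (simp add: c_def[abs_def])
      qed (simp add: c_def[abs_def])
    qed
  qed
  ultimately have "(\<integral>\<^sup>+x. enn_powr (dyadic_maximal \<sigma> f x) p * nu p ps \<sigma> x \<partial>lebesgue) \<le> enn_powr (infprod ?e) p"
    by simp
  from enn_powr_mono[OF this, of "1 / p"] show ?thesis
    using p_pos by (simp add: Lp_norm_def)
qed

end

end

theorem lemma3p7:
  fixes ps :: "nat \<Rightarrow> real" and p A :: real
    and \<omega> \<sigma> :: "nat \<Rightarrow> real^'n \<Rightarrow> real"
    and a :: "(real^'n) set \<Rightarrow> real"
  assumes ps: "\<And>i. 1 < ps i"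
    and summ: "summable (\<lambda>i. 1 / ps i)"
    and p: "1 / p = (\<Sum>i. 1 / ps i)"
    and weight: "\<And>i. weight (\<omega> i)"
    and sigma: "\<And>i x. \<sigma> i x = \<omega> i x powr (- (1 / (ps i - 1)))"
    and E_prod: "\<And>k x. prod_finite (\<lambda>i. ennreal (E k (\<sigma> i) x powr (1 / conj_exp (ps i))))"
    and sigma_prod: "AE x in lebesgue. prod_converges (\<lambda>i. ennreal (\<sigma> i x powr (1 / ps i))) \<and>
                       0 < infprod (\<lambda>i. ennreal (\<sigma> i x powr (1 / ps i)))"
    and sigma_chi: "\<And>B. B \<in> dyadic \<Longrightarrow> in_prod_Lp ps \<omega> (\<lambda>i x. \<sigma> i x * indicator B x)"
    and a_nonneg: "\<And>B. B \<in> dyadic \<Longrightarrow> 0 \<le> a B"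
    and A: "0 < A"
    and carleson: "\<And>G. G \<in> dyadic \<Longrightarrow>
           (\<Sum>\<^sub>\<infinity>B\<in>{B\<in>dyadic. B \<subseteq> G}. ennreal (a B)) \<le> ennreal A * (\<integral>\<^sup>+x\<in>G. nu p ps \<sigma> x \<partial>lebesgue)"
  shows "\<forall>f. in_prod_Lp ps \<sigma> f \<longrightarrow>
      enn_powr (\<Sum>\<^sub>\<infinity>B\<in>dyadic.
           ennreal (a B) * enn_powr (infprod (\<lambda>i. waverage (\<sigma> i) B (f i))) p) (1 / p)
        \<le> ennreal (A powr (1 / p)) * Lp_norm p (nu p ps \<sigma>) (dyadic_maximal \<sigma> f) \<and>
      ennreal (A powr (1 / p)) * Lp_norm p (nu p ps \<sigma>) (dyadic_maximal \<sigma> f)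
        \<le> ennreal (A powr (1 / p)) *
           infprod (\<lambda>i. ennreal (conj_exp (ps i)) * real_Lp_norm (ps i) (\<sigma> i) (f i))"
proof -
  have sums: "(\<lambda>i. 1 / ps i) sums (1 / p)"
    using summ p by (simp add: sums_iff)
  have \<omega>_pos: "AE x in lebesgue. 0 < \<omega> i x" and \<omega>_measurable [measurable]: "\<omega> i \<in> borel_measurable lebesgue" for i
    using weight[of i] by (auto simp: weight_def)
  have \<sigma>_measurable: "\<sigma> i \<in> borel_measurable lebesgue" for i
    unfolding sigma[abs_def] by measurable
  have \<sigma>_nonneg: "0 \<le> \<sigma> i x" for i x
    by (simp add: sigma)
  \<comment> \<open>The exponent in \<sigma>_i is made for \<sigma>_i^(p_i) \<omega>_i = \<sigma>_i,
    which holds wherever \<omega>_i is positive and turns the assumption on \<sigma>_i \<chi>_B into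
    one on the masses \<sigma>_i(B).\<close>
  have norm_chi: "real_Lp_norm (ps i) (\<omega> i) (\<lambda>x. \<sigma> i x * indicator B x) =
      enn_powr (\<integral>\<^sup>+x\<in>B. ennreal (\<sigma> i x) \<partial>lebesgue) (1 / ps i)" for i B
    unfolding Lp_norm_def
  proof (intro arg_cong2[where f = enn_powr] refl nn_integral_cong_AE, use \<omega>_pos[of i] in eventually_elim)
    case (elim x)
    have "\<sigma> i x powr ps i * \<omega> i x = \<omega> i x powr (- (1 / (ps i - 1)) * ps i + 1)"
      unfolding powr_add using elim by (simp add: sigma powr_powr)
    also have "- (1 / (ps i - 1)) * ps i + 1 = - (1 / (ps i - 1))"
      using ps[of i] by (simp add: field_simps)
    finally have "\<sigma> i x powr ps i * \<omega> i x = \<sigma> i x"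
      by (simp add: sigma)
    then show ?case
      using \<sigma>_nonneg[of i x] elim
      by (auto simp: indicator_def enn_powr_ennreal simp flip: ennreal_mult)
  qed
  interpret weight_sequence ps p \<sigma>
  proof
    show "AE x in lebesgue. 0 < \<sigma> i x" for i
      using \<omega>_pos[of i] by eventually_elim (simp add: sigma)
    fix B :: "(real^'n) set" assume "B \<in> dyadic"
    from sigma_chi[OF this, unfolded in_prod_Lp_def norm_chi]
    show "prod_finite (\<lambda>i. enn_powr (\<integral>\<^sup>+x\<in>B. ennreal (\<sigma> i x) \<partial>lebesgue) (1 / ps i))"
      and "(\<integral>\<^sup>+x\<in>B. ennreal (\<sigma> i x) \<partial>lebesgue) < \<infinity>" for i
      by auto
  qed (use ps sums \<sigma>_measurable \<sigma>_nonneg sigma_prod in auto)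
  show ?thesis
  proof (intro allI impI conjI)
    fix f assume f: "in_prod_Lp ps \<sigma> f"
    let ?I = "\<integral>\<^sup>+x. enn_powr (dyadic_maximal \<sigma> f x) p * nu p ps \<sigma> x \<partial>lebesgue"
    have "enn_powr (\<Sum>\<^sub>\<infinity>B\<in>dyadic. ennreal (a B) * enn_powr (infprod (\<lambda>i. waverage (\<sigma> i) B (f i))) p) (1 / p)
        \<le> enn_powr (ennreal A * ?I) (1 / p)"
      using p_pos by (intro enn_powr_mono Carleson_embedding[OF f a_nonneg A carleson]) auto
    then show "enn_powr (\<Sum>\<^sub>\<infinity>B\<in>dyadic. ennreal (a B) * enn_powr (infprod (\<lambda>i. waverage (\<sigma> i) B (f i))) p) (1 / p)
        \<le> ennreal (A powr (1 / p)) * Lp_norm p (nu p ps \<sigma>) (dyadic_maximal \<sigma> f)"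
      using A by (simp add: Lp_norm_def enn_powr_mult enn_powr_ennreal)
    show "ennreal (A powr (1 / p)) * Lp_norm p (nu p ps \<sigma>) (dyadic_maximal \<sigma> f)
        \<le> ennreal (A powr (1 / p)) *
           infprod (\<lambda>i. ennreal (conj_exp (ps i)) * real_Lp_norm (ps i) (\<sigma> i) (f i))"
      by (intro mult_left_mono dyadic_maximal_le[OF f]) simp
  qed
qed

end
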